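(* Let $H\in(\frac12,1)$, $\theta>0$, and let $X_t=e^{\theta t}\int_0^te^{-\theta s}dB^H_s$ be the solution of $dX_t=\theta X_tdt+dB^H_t$, $X_0=0$. Define $$\widetilde\theta^{(2)}_T=\frac{\int_0^Te^{-2\theta s}X_sdX_s}{\int_0^Te^{-2\theta s}X_s^2ds}.$$ Then $\widetilde\theta^{(2)}_T\to\theta$ a.s. as $T\to\infty$.
   Context: $B^H$ is a fractional Brownian motion with Hurst index $H$ (centered Gaussian, $B^H_0=0$, $EB^H_tB^H_s=\frac12(t^{2H}+s^{2H}-|t-s|^{2H})$); integrals w.r.t. $B^H$ and $X$ are pathwise (Riemann–Stieltjes/generalized Lebesgue–Stieltjes) integrals. *)

theory Defs
  imports "HOL-Probability.Probability"
begin

definition has_RS_integral ::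
  "(real \<Rightarrow> real) \<Rightarrow> (real \<Rightarrow> real) \<Rightarrow> real \<Rightarrow> real \<Rightarrow> real \<Rightarrow> bool" where
  "has_RS_integral f g a b I \<longleftrightarrow>
     (\<forall>\<epsilon>>0. \<exists>\<delta>>0. \<forall>(n::nat) (t::nat \<Rightarrow> real) (\<xi>::nat \<Rightarrow> real).
        (t 0 = a \<and> t n = b \<and>
         (\<forall>i<n. t i < t (Suc i) \<and> t (Suc i) - t i < \<delta> \<and> t i \<le> \<xi> i \<and> \<xi> i \<le> t (Suc i)))
        \<longrightarrow> \<bar>(\<Sum>i<n. f (\<xi> i) * (g (t (Suc i)) - g (t i))) - I\<bar> < \<epsilon>)"

definition RS_integral ::
  "(real \<Rightarrow> real) \<Rightarrow> (real \<Rightarrow> real) \<Rightarrow> real \<Rightarrow> real \<Rightarrow> real" where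
  "RS_integral f g a b = (THE I. has_RS_integral f g a b I)"

definition centered_gaussian :: "'a measure \<Rightarrow> ('a \<Rightarrow> real) \<Rightarrow> bool" where
  "centered_gaussian M Y \<longleftrightarrow>
     Y \<in> borel_measurable M \<and>
     ((AE \<omega> in M. Y \<omega> = 0) \<or>
      (\<exists>\<sigma>>0. distributed M lborel Y (\<lambda>x. ennreal (normal_density 0 \<sigma> x))))"

definition fBm :: "'a measure \<Rightarrow> real \<Rightarrow> (real \<Rightarrow> 'a \<Rightarrow> real) \<Rightarrow> bool" where
  "fBm M H B \<longleftrightarrow>
     prob_space M \<and>
     (\<forall>t\<ge>0. B t \<in> borel_measurable M) \<and>
     (\<forall>(n::nat) (ts::nat \<Rightarrow> real) (cs::nat \<Rightarrow> real). (\<forall>i<n. ts i \<ge> 0) \<longrightarrow>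
        centered_gaussian M (\<lambda>\<omega>. \<Sum>i<n. cs i * B (ts i) \<omega>)) \<and>
     (\<forall>\<omega>\<in>space M. B 0 \<omega> = 0) \<and>
     (\<forall>t s. t \<ge> 0 \<longrightarrow> s \<ge> 0 \<longrightarrow>
        prob_space.expectation M (\<lambda>\<omega>. B t \<omega> * B s \<omega>)
          = (t powr (2*H) + s powr (2*H) - \<bar>t - s\<bar> powr (2*H)) / 2)"

end

theory Submission
  imports Defs
begin

text \<open>Integration by parts gives X(t) = exp(\<theta>t) Z(t), where Z(t) = exp(-\<theta>t) B(t) + \<theta> J(t) and J(t) is the
  integral of exp(-\<theta>s) B(s) over [0, t]. Since H > 1/2, almost all paths have vanishing quadratic
  variation, so the ordinary chain rule turns the numerator of the estimator into Z(T)^2 / 2 plus \<theta> times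
  the denominator, which is the integral of Z(s)^2 over [0, T]. The paths of B grow at most
  quadratically, so Z(T) converges; if the limit is nonzero, then the denominator tends to infinity
  while Z(T)^2 stays bounded.

  A Borel-Cantelli argument for the dyadic increments of mesh 2^(-n) over the growing range [0, 2^n]
  yields both the path regularity and the growth bound. That the limit of Z is almost surely nonzero
  follows because increments of B are nonnegatively correlated: the Riemann sums of Z over [0, n], n \<ge> 1,
  have variance at least exp(-2\<theta>), so they are small only with small probability, uniformly, and this
  passes to the limit.\<close>

section \<open>Riemann-Stieltjes integrals\<close>

text \<open>The integrals demand convergence over all fine partitions with arbitrary tags, and
  \<open>RS_integral\<close> is a definite description, so existence and uniqueness must both be
  settled before \<open>X\<close> or the estimator has a usable value. Existence is reduced to a
  local error of size o(t - s) on each cell. For the numerator this error contains squared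
  increments on the two sides of the tag, which is why (g t - g s)^2 = o(t - s) is the regularity
  asked of the paths.

  The dyadic constants come from a union bound: level n has 4^n increments of variance v^n, where v
  = 2^(-2H) < 1/2. A rate q with v < q^2 < 1/2 leaves a gap on both sides: the upper one yields the
  o(t - s) bound, the lower one yields tails that a high enough moment makes smaller than any given
  geometric rate.

  The law of the limit of Z is never identified. The constant exp(-2\<theta>) is the contribution of
  [0, 1] alone, where the discount is at least exp(-\<theta>) and B(1) has variance 1.\<close>

lemma has_RS_integralI:
  assumes "\<And>\<epsilon>::real. \<epsilon> > 0 \<Longrightarrow> \<exists>\<delta>>0. \<forall>s x t. a \<le> s \<and> s \<le> x \<and> x \<le> t \<and> t \<le> b \<and> t - s < \<delta> \<longrightarrow>
      \<bar>f x * (g t - g s) - (G t - G s)\<bar> \<le> \<epsilon> * (t - s)"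
  shows "has_RS_integral f g a b (G b - G a)"
  unfolding has_RS_integral_def
proof (intro allI impI)
  fix \<epsilon> :: real assume "\<epsilon> > 0"
  \<comment> \<open>The \<open>+ 1\<close> avoids division by zero when a = b and makes the final
    inequality strict.\<close>
  define \<epsilon>' where "\<epsilon>' = \<epsilon> / (\<bar>b - a\<bar> + 1)"
  have "\<epsilon>' > 0" unfolding \<epsilon>'_def using \<open>\<epsilon> > 0\<close> by simp
  then obtain \<delta> where "\<delta> > 0" and \<delta>: "\<And>s x t. a \<le> s \<Longrightarrow> s \<le> x \<Longrightarrow> x \<le> t \<Longrightarrow> t \<le> b \<Longrightarrow> t - s < \<delta> \<Longrightarrow>
      \<bar>f x * (g t - g s) - (G t - G s)\<bar> \<le> \<epsilon>' * (t - s)"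
    using assms[of \<epsilon>'] by metis
  show "\<exists>\<delta>>0. \<forall>(n::nat) (t::nat \<Rightarrow> real) (\<xi>::nat \<Rightarrow> real).
        (t 0 = a \<and> t n = b \<and>
         (\<forall>i<n. t i < t (Suc i) \<and> t (Suc i) - t i < \<delta> \<and> t i \<le> \<xi> i \<and> \<xi> i \<le> t (Suc i)))
        \<longrightarrow> \<bar>(\<Sum>i<n. f (\<xi> i) * (g (t (Suc i)) - g (t i))) - (G b - G a)\<bar> < \<epsilon>"
  proof (rule exI[of _ \<delta>], intro conjI allI impI)
    fix n :: nat and t \<xi> :: "nat \<Rightarrow> real"
    assume *: "t 0 = a \<and> t n = b \<and>
         (\<forall>i<n. t i < t (Suc i) \<and> t (Suc i) - t i < \<delta> \<and> t i \<le> \<xi> i \<and> \<xi> i \<le> t (Suc i))"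
    have le: "t i \<le> t j" if "i \<le> j" "j \<le> n" for i j
      using that
    proof (induction j rule: dec_induct)
      case (step m)
      then have "t m < t (Suc m)" using * by auto
      with step show ?case by auto
    qed simp
    have "(\<Sum>i<n. f (\<xi> i) * (g (t (Suc i)) - g (t i))) - (G b - G a)
        = (\<Sum>i<n. f (\<xi> i) * (g (t (Suc i)) - g (t i)) - (G (t (Suc i)) - G (t i)))"
      using sum_lessThan_telescope[of "\<lambda>i. G (t i)" n] * by (simp add: sum_subtractf)
    also have "\<bar>\<dots>\<bar> \<le> (\<Sum>i<n. \<bar>f (\<xi> i) * (g (t (Suc i)) - g (t i)) - (G (t (Suc i)) - G (t i))\<bar>)"
      by (rule sum_abs)
    also have "\<dots> \<le> (\<Sum>i<n. \<epsilon>' * (t (Suc i) - t i))"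
    proof (rule sum_mono)
      fix i assume "i \<in> {..<n}"
      then show "\<bar>f (\<xi> i) * (g (t (Suc i)) - g (t i)) - (G (t (Suc i)) - G (t i))\<bar> \<le> \<epsilon>' * (t (Suc i) - t i)"
        using * le[of 0 i] le[of "Suc i" n] by (intro \<delta>) auto
    qed
    also have "\<dots> = \<epsilon>' * (b - a)"
      using sum_lessThan_telescope[of t n] * by (simp add: sum_distrib_left[symmetric])
    also have "\<dots> < \<epsilon>"
    proof -
      have "\<epsilon>' * (b - a) < \<epsilon>' * (\<bar>b - a\<bar> + 1)"
        by (intro mult_strict_left_mono \<open>\<epsilon>' > 0\<close>) auto
      also have "\<dots> = \<epsilon>" unfolding \<epsilon>'_def by (simp add: add_pos_nonneg)
      finally show ?thesis .
    qed
    finally show "\<bar>(\<Sum>i<n. f (\<xi> i) * (g (t (Suc i)) - g (t i))) - (G b - G a)\<bar> < \<epsilon>" .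
  qed (fact \<open>\<delta> > 0\<close>)
qed

lemma has_RS_integralE:
  assumes "has_RS_integral f g a b I" "\<epsilon> > 0"
  obtains \<delta> where "\<delta> > 0" "\<And>(n::nat) t \<xi>. t 0 = a \<Longrightarrow> t n = b \<Longrightarrow>
         (\<forall>i<n. t i < t (Suc i) \<and> t (Suc i) - t i < \<delta> \<and> t i \<le> \<xi> i \<and> \<xi> i \<le> t (Suc i)) \<Longrightarrow>
        \<bar>(\<Sum>i<n. f (\<xi> i) * (g (t (Suc i)) - g (t i))) - I\<bar> < \<epsilon>"
proof -
  from assms(1)[unfolded has_RS_integral_def, THEN spec, THEN mp, OF assms(2)]
  obtain \<delta> where "\<delta> > 0" and \<delta>: "\<forall>(n::nat) (t::nat \<Rightarrow> real) (\<xi>::nat \<Rightarrow> real).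
        (t 0 = a \<and> t n = b \<and>
         (\<forall>i<n. t i < t (Suc i) \<and> t (Suc i) - t i < \<delta> \<and> t i \<le> \<xi> i \<and> \<xi> i \<le> t (Suc i)))
        \<longrightarrow> \<bar>(\<Sum>i<n. f (\<xi> i) * (g (t (Suc i)) - g (t i))) - I\<bar> < \<epsilon>"
    by blast
  show ?thesis
    by (rule that[OF \<open>\<delta> > 0\<close>]) (rule \<delta>[rule_format], simp)
qed

text \<open>Links a pathwise integral to probability: the approximating sums use deterministic
  times, so for a Gaussian process they are Gaussian variables.\<close>

lemma has_RS_integral_uniform_sums:
  assumes "has_RS_integral f g 0 (real N) I"
  shows "(\<lambda>m. \<Sum>i<N * Suc m. f (real i / real (Suc m)) *
           (g (real (Suc i) / real (Suc m)) - g (real i / real (Suc m)))) \<longlonglongrightarrow> I"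
proof (rule LIMSEQ_I)
  fix \<epsilon> :: real assume "\<epsilon> > 0"
  from has_RS_integralE[OF assms this] obtain \<delta> where "\<delta> > 0" and \<delta>: "\<And>n t \<xi>. t 0 = 0 \<Longrightarrow> t n = real N \<Longrightarrow>
         (\<forall>i<n. t i < t (Suc i) \<and> t (Suc i) - t i < \<delta> \<and> t i \<le> \<xi> i \<and> \<xi> i \<le> t (Suc i)) \<Longrightarrow>
        \<bar>(\<Sum>i<n. f (\<xi> i) * (g (t (Suc i)) - g (t i))) - I\<bar> < \<epsilon>"
    by blast
  obtain m0 where m0: "1 / real (Suc m0) < \<delta>"
    using nat_approx_posE[OF \<open>\<delta> > 0\<close>] by blast
  show "\<exists>m0. \<forall>m\<ge>m0. norm ((\<Sum>i<N * Suc m. f (real i / real (Suc m)) *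
           (g (real (Suc i) / real (Suc m)) - g (real i / real (Suc m)))) - I) < \<epsilon>"
  proof (intro exI[of _ m0] allI impI, unfold real_norm_def, rule \<delta>)
    fix m assume "m0 \<le> m"
    then have "1 / real (Suc m) \<le> 1 / real (Suc m0)" by (simp add: frac_le)
    with m0 have "1 / real (Suc m) < \<delta>" by linarith
    then show "\<forall>i<N * Suc m. real i / real (Suc m) < real (Suc i) / real (Suc m) \<and>
        real (Suc i) / real (Suc m) - real i / real (Suc m) < \<delta> \<and>
        real i / real (Suc m) \<le> real i / real (Suc m) \<and> real i / real (Suc m) \<le> real (Suc i) / real (Suc m)"
      by (auto simp: divide_simps)
  qed (simp_all add: field_simps)
qed

text \<open>One partition finer than both meshes puts the same sum close to I and to J. The order of
  the endpoints matters: for b < a there is no partition at all, and every number would be an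
  integral.\<close>

lemma has_RS_integral_unique:
  assumes "a \<le> b" "has_RS_integral f g a b I" "has_RS_integral f g a b J"
  shows "I = J"
proof (rule ccontr)
  assume "I \<noteq> J"
  define \<epsilon> where "\<epsilon> = \<bar>I - J\<bar> / 2"
  have "\<epsilon> > 0" using \<open>I \<noteq> J\<close> by (simp add: \<epsilon>_def)
  obtain d1 where "d1 > 0" and d1: "\<And>n t \<xi>. t 0 = a \<Longrightarrow> t n = b \<Longrightarrow>
         (\<forall>i<n. t i < t (Suc i) \<and> t (Suc i) - t i < d1 \<and> t i \<le> \<xi> i \<and> \<xi> i \<le> t (Suc i)) \<Longrightarrow>
        \<bar>(\<Sum>i<n. f (\<xi> i) * (g (t (Suc i)) - g (t i))) - I\<bar> < \<epsilon>"
    by (rule has_RS_integralE[OF assms(2) \<open>\<epsilon> > 0\<close>]) blast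
  obtain d2 where "d2 > 0" and d2: "\<And>n t \<xi>. t 0 = a \<Longrightarrow> t n = b \<Longrightarrow>
         (\<forall>i<n. t i < t (Suc i) \<and> t (Suc i) - t i < d2 \<and> t i \<le> \<xi> i \<and> \<xi> i \<le> t (Suc i)) \<Longrightarrow>
        \<bar>(\<Sum>i<n. f (\<xi> i) * (g (t (Suc i)) - g (t i))) - J\<bar> < \<epsilon>"
    by (rule has_RS_integralE[OF assms(3) \<open>\<epsilon> > 0\<close>]) blast
  obtain n t where t: "t 0 = a" "t n = b"
    "\<And>i. i < n \<Longrightarrow> t i < t (Suc i) \<and> t (Suc i) - t i < min d1 d2"
  proof (cases "a = b")
    case True
    \<comment> \<open>Partition points increase strictly, so a = b admits only the partition with no
      cells.\<close>
    then show ?thesis by (intro that[of "\<lambda>_. a" 0]) auto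
  next
    case False
    have "min d1 d2 / (b - a) > 0" using \<open>d1 > 0\<close> \<open>d2 > 0\<close> False assms(1) by simp
    then obtain m where m: "1 / real (Suc m) < min d1 d2 / (b - a)"
      using nat_approx_posE by blast
    define t where "t i = a + real i * ((b - a) / real (Suc m))" for i
    have *: "t (Suc i) - t i = (b - a) / real (Suc m)" for i by (simp add: t_def algebra_simps add_divide_distrib diff_divide_distrib)
    have "t 0 = a" "t (Suc m) = b" by (simp_all add: t_def del: of_nat_Suc)
    moreover have "(b - a) / real (Suc m) < min d1 d2" "(b - a) / real (Suc m) > 0"
      using m False assms(1) by (simp_all add: field_simps)
    ultimately show ?thesis using * by (intro that[of t "Suc m"]) (auto simp: less_diff_eq algebra_simps)
  qed
  have "\<bar>(\<Sum>i<n. f (t i) * (g (t (Suc i)) - g (t i))) - I\<bar> < \<epsilon>"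
    using t by (intro d1) (auto simp: less_imp_le)
  moreover have "\<bar>(\<Sum>i<n. f (t i) * (g (t (Suc i)) - g (t i))) - J\<bar> < \<epsilon>"
    using t by (intro d2) (auto simp: less_imp_le)
  ultimately have "\<bar>I - J\<bar> < 2 * \<epsilon>" by linarith
  then show False by (simp add: \<epsilon>_def)
qed

lemma RS_integral_eq:
  assumes "a \<le> b" "has_RS_integral f g a b I"
  shows "RS_integral f g a b = I"
  unfolding RS_integral_def using assms has_RS_integral_unique by blast

text \<open>G is the primitive suggested by integrating by parts. The local error splits into (f x -
  f s)(g t - g s) and the integral of f' u (g t - g u) over [s, t]. Each is a factor L (t - s) times
  an oscillation of g below \<epsilon>/(2L), so mere continuity of g suffices.\<close>

lemma RS_by_parts_local_bound:
  fixes f f' g :: "real \<Rightarrow> real"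
  assumes f: "\<And>x. x \<in> {a..b} \<Longrightarrow> (f has_real_derivative f' x) (at x within {a..b})"
    and f': "continuous_on {a..b} f'" and g: "continuous_on {a..b} g" and "\<epsilon> > 0"
  defines "G \<equiv> \<lambda>t. f t * g t - integral {a..t} (\<lambda>u. f' u * g u)"
  shows "\<exists>\<delta>>0. \<forall>s x t. a \<le> s \<and> s \<le> x \<and> x \<le> t \<and> t \<le> b \<and> t - s < \<delta> \<longrightarrow>
      \<bar>f x * (g t - g s) - (G t - G s)\<bar> \<le> \<epsilon> * (t - s)"
proof -
  obtain L where "L > 0" and L: "\<And>x. x \<in> {a..b} \<Longrightarrow> \<bar>f' x\<bar> \<le> L"
    using compact_imp_bounded[OF compact_continuous_image[OF f' compact_Icc]]
    by (auto simp: bounded_pos)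
  obtain \<delta> where "\<delta> > 0" and \<delta>: "\<And>u v. u \<in> {a..b} \<Longrightarrow> v \<in> {a..b} \<Longrightarrow> dist u v < \<delta> \<Longrightarrow> dist (g u) (g v) < \<epsilon> / (2 * L)"
    using compact_uniformly_continuous[OF g compact_Icc] \<open>\<epsilon> > 0\<close> \<open>L > 0\<close>
    unfolding uniformly_continuous_on_def by (metis divide_pos_pos mult_pos_pos zero_less_numeral)
  show ?thesis
  proof (intro exI[of _ \<delta>] conjI allI impI)
    fix s x t assume *: "a \<le> s \<and> s \<le> x \<and> x \<le> t \<and> t \<le> b \<and> t - s < \<delta>"
    have sub: "{s..t} \<subseteq> {a..b}" "{a..t} \<subseteq> {a..b}" using * by auto
    have int_f': "(f' has_integral (f t - f s)) {s..t}"
    proof (rule fundamental_theorem_of_calculus)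
      fix y assume "y \<in> {s..t}"
      then show "(f has_vector_derivative f' y) (at y within {s..t})"
        using has_field_derivative_subset[OF f sub(1)] sub(1)
        by (auto simp: has_real_derivative_iff_has_vector_derivative[symmetric])
    qed (use * in auto)
    have contfg: "continuous_on {a..b} (\<lambda>u. f' u * g u)" by (intro continuous_intros f' g)
    have int_fg: "(\<lambda>u. f' u * g u) integrable_on {a..t}"
      using integrable_continuous_interval continuous_on_subset[OF contfg sub(2)] by blast
    have GG: "integral {a..t} (\<lambda>u. f' u * g u) - integral {a..s} (\<lambda>u. f' u * g u)
        = integral {s..t} (\<lambda>u. f' u * g u)"
      using Henstock_Kurzweil_Integration.integral_combine[OF _ _ int_fg, of s] * by auto
    have "((\<lambda>u. f' u * g t - f' u * g u) has_integral
        (f t - f s) * g t - integral {s..t} (\<lambda>u. f' u * g u)) {s..t}"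
      by (intro has_integral_diff has_integral_mult_left int_f' integrable_integral
            integrable_continuous_interval continuous_on_subset[OF contfg sub(1)])
    then have "integral {s..t} (\<lambda>u. f' u * (g t - g u)) = (f t - f s) * g t - integral {s..t} (\<lambda>u. f' u * g u)"
      by (metis (no_types, lifting) ext integral_unique right_diff_distrib)
    then have eq: "f x * (g t - g s) - (G t - G s) = (f x - f s) * (g t - g s) - integral {s..t} (\<lambda>u. f' u * (g t - g u))"
      using GG unfolding G_def by (simp add: algebra_simps)
    have g_small: "\<bar>g u - g v\<bar> \<le> \<epsilon> / (2 * L)" if "u \<in> {s..t}" "v \<in> {s..t}" for u v
    proof -
      have "u \<in> {a..b}" "v \<in> {a..b}" "dist u v < \<delta>" using that * by (auto simp: dist_real_def)
      from \<delta>[OF this] show ?thesis by (simp add: dist_real_def)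
    qed
    have "\<bar>f x - f s\<bar> \<le> L * \<bar>x - s\<bar>"
      using field_differentiable_bound[of "{a..b}" f f' L x s] f L * by auto
    also have "\<dots> \<le> L * (t - s)" using * \<open>L > 0\<close> by auto
    finally have "\<bar>(f x - f s) * (g t - g s)\<bar> \<le> L * (t - s) * (\<epsilon> / (2 * L))"
      unfolding abs_mult using g_small[of t s] * \<open>L > 0\<close> by (intro mult_mono) auto
    also have "\<dots> = \<epsilon> / 2 * (t - s)" using \<open>L > 0\<close> by simp
    finally have 1: "\<bar>(f x - f s) * (g t - g s)\<bar> \<le> \<epsilon> / 2 * (t - s)" .
    have "norm (integral {s..t} (\<lambda>u. f' u * (g t - g u))) \<le> (L * (\<epsilon> / (2 * L))) * (t - s)"
    proof (rule integral_bound)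
      show "continuous_on {s..t} (\<lambda>u. f' u * (g t - g u))"
        by (intro continuous_intros continuous_on_subset[OF f' sub(1)] continuous_on_subset[OF g sub(1)])
      fix u assume "u \<in> {s..t}"
      then show "norm (f' u * (g t - g u)) \<le> L * (\<epsilon> / (2 * L))"
        unfolding real_norm_def abs_mult using g_small[of t u] * sub L \<open>L > 0\<close> by (intro mult_mono) auto
    qed (use * in auto)
    then have 2: "\<bar>integral {s..t} (\<lambda>u. f' u * (g t - g u))\<bar> \<le> \<epsilon> / 2 * (t - s)"
      using \<open>L > 0\<close> by simp
    show "\<bar>f x * (g t - g s) - (G t - G s)\<bar> \<le> \<epsilon> * (t - s)"
      unfolding eq using 1 2 abs_triangle_ineq4[of "(f x - f s) * (g t - g s)" "integral {s..t} (\<lambda>u. f' u * (g t - g u))"]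
      by simp
  qed (fact \<open>\<delta> > 0\<close>)
qed

lemma has_RS_integral_by_parts:
  fixes f f' g :: "real \<Rightarrow> real"
  assumes "\<And>x. x \<in> {a..b} \<Longrightarrow> (f has_real_derivative f' x) (at x within {a..b})"
    and "continuous_on {a..b} f'" and "continuous_on {a..b} g"
  shows "has_RS_integral f g a b (f b * g b - f a * g a - integral {a..b} (\<lambda>u. f' u * g u))"
  using has_RS_integralI[OF RS_by_parts_local_bound[OF assms]] by (simp add: algebra_simps)

text \<open>The little 1/2-Hoelder condition: it makes quadratic variation vanish uniformly over partitions, so
  that the ordinary chain rule holds with arbitrary tags.\<close>

definition little_half_holder :: "(real \<Rightarrow> real) \<Rightarrow> real \<Rightarrow> real \<Rightarrow> bool" where
  "little_half_holder g a b \<longleftrightarrow>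
     (\<forall>\<epsilon>>0. \<exists>\<delta>>0. \<forall>s t. a \<le> s \<and> s \<le> t \<and> t \<le> b \<and> t - s < \<delta> \<longrightarrow> (g t - g s)\<^sup>2 \<le> \<epsilon> * (t - s))"

lemma little_half_holder_lipschitz:
  assumes "\<And>s t. a \<le> s \<Longrightarrow> s \<le> t \<Longrightarrow> t \<le> b \<Longrightarrow> \<bar>g t - g s\<bar> \<le> L * (t - s)"
  shows "little_half_holder g a b"
  unfolding little_half_holder_def
proof (intro allI impI)
  fix \<epsilon> :: real assume "\<epsilon> > 0"
  have pos: "L\<^sup>2 + 1 > 0" by (simp add: add_nonneg_pos)
  show "\<exists>\<delta>>0. \<forall>s t. a \<le> s \<and> s \<le> t \<and> t \<le> b \<and> t - s < \<delta> \<longrightarrow> (g t - g s)\<^sup>2 \<le> \<epsilon> * (t - s)"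
  proof (intro exI[of _ "\<epsilon> / (L\<^sup>2 + 1)"] conjI allI impI)
    fix s t assume *: "a \<le> s \<and> s \<le> t \<and> t \<le> b \<and> t - s < \<epsilon> / (L\<^sup>2 + 1)"
    then have "(L\<^sup>2 + 1) * (t - s) \<le> \<epsilon>" using pos by (simp add: field_simps)
    moreover have "L\<^sup>2 * (t - s) \<le> (L\<^sup>2 + 1) * (t - s)" using * by (intro mult_right_mono) auto
    ultimately have "L\<^sup>2 * (t - s) * (t - s) \<le> \<epsilon> * (t - s)" using * by (intro mult_right_mono) auto
    moreover have "(g t - g s)\<^sup>2 \<le> (L * (t - s))\<^sup>2"
      using assms[of s t] * by (intro abs_le_square_iff[THEN iffD1]) auto
    ultimately show "(g t - g s)\<^sup>2 \<le> \<epsilon> * (t - s)" by (simp add: power2_eq_square algebra_simps)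
  qed (use \<open>\<epsilon> > 0\<close> pos in auto)
qed

lemma little_half_holder_add:
  assumes "little_half_holder f a b" "little_half_holder g a b"
  shows "little_half_holder (\<lambda>x. f x + g x) a b"
  unfolding little_half_holder_def
proof (intro allI impI)
  fix \<epsilon> :: real assume "\<epsilon> > 0"
  then have "\<epsilon> / 4 > 0" by simp
  obtain d1 where "d1 > 0" and d1: "\<And>s t. a \<le> s \<and> s \<le> t \<and> t \<le> b \<and> t - s < d1 \<Longrightarrow> (f t - f s)\<^sup>2 \<le> \<epsilon> / 4 * (t - s)"
    using assms(1) \<open>\<epsilon> / 4 > 0\<close> unfolding little_half_holder_def by metis
  obtain d2 where "d2 > 0" and d2: "\<And>s t. a \<le> s \<and> s \<le> t \<and> t \<le> b \<and> t - s < d2 \<Longrightarrow> (g t - g s)\<^sup>2 \<le> \<epsilon> / 4 * (t - s)"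
    using assms(2) \<open>\<epsilon> / 4 > 0\<close> unfolding little_half_holder_def by metis
  show "\<exists>\<delta>>0. \<forall>s t. a \<le> s \<and> s \<le> t \<and> t \<le> b \<and> t - s < \<delta> \<longrightarrow> (f t + g t - (f s + g s))\<^sup>2 \<le> \<epsilon> * (t - s)"
  proof (intro exI[of _ "min d1 d2"] conjI allI impI)
    fix s t assume *: "a \<le> s \<and> s \<le> t \<and> t \<le> b \<and> t - s < min d1 d2"
    have "(f t + g t - (f s + g s))\<^sup>2 \<le> 2 * (f t - f s)\<^sup>2 + 2 * (g t - g s)\<^sup>2"
      using sum_squares_bound[of "f t - f s" "g t - g s"]
      by (simp add: power2_eq_square algebra_simps)
    also have "\<dots> \<le> \<epsilon> * (t - s)" using d1[of s t] d2[of s t] * by auto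
    finally show "(f t + g t - (f s + g s))\<^sup>2 \<le> \<epsilon> * (t - s)" .
  qed (use \<open>d1 > 0\<close> \<open>d2 > 0\<close> in auto)
qed

text \<open>Compare w g dg with half of w d(g^2). The latter is covered by
  \<open>RS_by_parts_local_bound\<close> with integrator g^2; the discrepancy is quadratic in the
  increments of g, hence o(t - s) by the little 1/2-Hoelder condition.\<close>

lemma has_RS_integral_chain_rule:
  fixes w w' g :: "real \<Rightarrow> real"
  assumes w: "\<And>x. x \<in> {a..b} \<Longrightarrow> (w has_real_derivative w' x) (at x within {a..b})"
    and w': "continuous_on {a..b} w'" and g: "continuous_on {a..b} g"
    and h: "little_half_holder g a b"
  shows "has_RS_integral (\<lambda>x. w x * g x) g a b
    (w b * (g b)\<^sup>2 / 2 - w a * (g a)\<^sup>2 / 2 - integral {a..b} (\<lambda>u. w' u * (g u)\<^sup>2) / 2)"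
proof -
  define G where "G t = w t * (g t)\<^sup>2 - integral {a..t} (\<lambda>u. w' u * (g u)\<^sup>2)" for t
  have "continuous_on {a..b} w"
    using w DERIV_continuous_on by blast
  then obtain L where "L > 0" and L: "\<And>x. x \<in> {a..b} \<Longrightarrow> \<bar>w x\<bar> \<le> L"
    using compact_imp_bounded[OF compact_continuous_image[OF _ compact_Icc, of a b w]]
    by (auto simp: bounded_pos)
  have "has_RS_integral (\<lambda>x. w x * g x) g a b (G b / 2 - G a / 2)"
  proof (rule has_RS_integralI)
    fix \<epsilon> :: real assume "\<epsilon> > 0"
    then have "\<epsilon> / (2 * L) > 0" using \<open>L > 0\<close> by simp
    obtain d1 where "d1 > 0" and d1: "\<And>s x t. a \<le> s \<and> s \<le> x \<and> x \<le> t \<and> t \<le> b \<and> t - s < d1 \<Longrightarrow>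
      \<bar>w x * ((g t)\<^sup>2 - (g s)\<^sup>2) - (G t - G s)\<bar> \<le> \<epsilon> * (t - s)"
      using RS_by_parts_local_bound[OF w w' continuous_on_power[OF g, of 2] \<open>\<epsilon> > 0\<close>]
      unfolding G_def[abs_def] by blast
    obtain d2 where "d2 > 0" and d2: "\<And>s t. a \<le> s \<and> s \<le> t \<and> t \<le> b \<and> t - s < d2 \<Longrightarrow> (g t - g s)\<^sup>2 \<le> \<epsilon> / (2 * L) * (t - s)"
      using h \<open>\<epsilon> / (2 * L) > 0\<close> unfolding little_half_holder_def by metis
    show "\<exists>\<delta>>0. \<forall>s x t. a \<le> s \<and> s \<le> x \<and> x \<le> t \<and> t \<le> b \<and> t - s < \<delta> \<longrightarrow>
      \<bar>w x * g x * (g t - g s) - (G t / 2 - G s / 2)\<bar> \<le> \<epsilon> * (t - s)"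
    proof (intro exI[of _ "min d1 d2"] conjI allI impI)
      fix s x t assume *: "a \<le> s \<and> s \<le> x \<and> x \<le> t \<and> t \<le> b \<and> t - s < min d1 d2"
      define A B where "A = g x - g s" and "B = g t - g x"
      have "\<epsilon> / (2 * L) * (x - s) \<le> \<epsilon> / (2 * L) * (t - s)" "\<epsilon> / (2 * L) * (t - x) \<le> \<epsilon> / (2 * L) * (t - s)"
        using * less_imp_le[OF \<open>\<epsilon> / (2 * L) > 0\<close>] by (intro mult_left_mono; linarith)+
      then have AB: "A\<^sup>2 \<le> \<epsilon> / (2 * L) * (t - s)" "B\<^sup>2 \<le> \<epsilon> / (2 * L) * (t - s)"
        using d2[of s x] d2[of x t] * unfolding A_def B_def by auto
      \<comment> \<open>The tag enters only through the deviation of its value from the trapezoidal value.\<close>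
      have eq: "w x * g x * (g t - g s) - (G t / 2 - G s / 2)
        = w x * ((A\<^sup>2 - B\<^sup>2) / 2) + (w x * ((g t)\<^sup>2 - (g s)\<^sup>2) - (G t - G s)) / 2"
        unfolding A_def B_def by (simp add: power2_eq_square field_simps)
      have "\<bar>A\<^sup>2 - B\<^sup>2\<bar> \<le> \<epsilon> / (2 * L) * (t - s)" using AB zero_le_power2[of A] zero_le_power2[of B] by linarith
      then have "\<bar>w x * ((A\<^sup>2 - B\<^sup>2) / 2)\<bar> \<le> L * (\<epsilon> / (2 * L) * (t - s))"
        unfolding abs_mult using L[of x] * \<open>L > 0\<close> by (intro mult_mono) auto
      then have "\<bar>w x * ((A\<^sup>2 - B\<^sup>2) / 2)\<bar> \<le> \<epsilon> * (t - s) / 2" using \<open>L > 0\<close> by simp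
      moreover have "\<bar>w x * ((g t)\<^sup>2 - (g s)\<^sup>2) - (G t - G s)\<bar> \<le> \<epsilon> * (t - s)"
        using * by (intro d1) auto
      moreover have "\<bar>p + r / 2\<bar> \<le> e" if "\<bar>p\<bar> \<le> e / 2" "\<bar>r\<bar> \<le> e" for p r e :: real
        using that by linarith
      ultimately show "\<bar>w x * g x * (g t - g s) - (G t / 2 - G s / 2)\<bar> \<le> \<epsilon> * (t - s)"
        unfolding eq by blast
    qed (use \<open>d1 > 0\<close> \<open>d2 > 0\<close> in auto)
  qed
  then show ?thesis unfolding G_def by (simp add: field_simps)
qed

lemma little_half_holder_cong:
  assumes "\<And>x. a \<le> x \<Longrightarrow> x \<le> b \<Longrightarrow> f x = g x" "little_half_holder g a b"
  shows "little_half_holder f a b"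
  unfolding little_half_holder_def
proof (intro allI impI)
  fix \<epsilon> :: real assume "\<epsilon> > 0"
  then obtain \<delta> where "\<delta> > 0" "\<forall>s t. a \<le> s \<and> s \<le> t \<and> t \<le> b \<and> t - s < \<delta> \<longrightarrow> (g t - g s)\<^sup>2 \<le> \<epsilon> * (t - s)"
    using assms(2) unfolding little_half_holder_def by blast
  then show "\<exists>\<delta>>0. \<forall>s t. a \<le> s \<and> s \<le> t \<and> t \<le> b \<and> t - s < \<delta> \<longrightarrow> (f t - f s)\<^sup>2 \<le> \<epsilon> * (t - s)"
    using assms(1) by (intro exI[of _ \<delta>]) auto
qed

lemma little_half_holder_C1:
  fixes f f' :: "real \<Rightarrow> real"
  assumes f: "\<And>x. x \<in> {a..b} \<Longrightarrow> (f has_real_derivative f' x) (at x within {a..b})"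
    and f': "continuous_on {a..b} f'"
  shows "little_half_holder f a b"
proof -
  obtain L where "L > 0" and L: "\<And>x. x \<in> {a..b} \<Longrightarrow> \<bar>f' x\<bar> \<le> L"
    using compact_imp_bounded[OF compact_continuous_image[OF f' compact_Icc]]
    by (auto simp: bounded_pos)
  show ?thesis
  proof (rule little_half_holder_lipschitz)
    fix s t assume "a \<le> s" "s \<le> t" "t \<le> b"
    then show "\<bar>f t - f s\<bar> \<le> L * (t - s)"
      using field_differentiable_bound[of "{a..b}" f f' L t s] f L by auto
  qed
qed

section \<open>Dyadic chaining\<close>

definition dyadic_floor :: "nat \<Rightarrow> real \<Rightarrow> real" where
  "dyadic_floor n x = real (nat \<lfloor>x * 2 ^ n\<rfloor>) / 2 ^ n"

lemma dyadic_floor_le: "x \<ge> 0 \<Longrightarrow> dyadic_floor n x \<le> x"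
  and dyadic_floor_ge: "x \<ge> 0 \<Longrightarrow> x - (1/2) ^ n \<le> dyadic_floor n x"
proof -
  assume "x \<ge> 0"
  then have "real (nat \<lfloor>x * 2 ^ n\<rfloor>) = of_int \<lfloor>x * 2 ^ n\<rfloor>" by simp
  then have "real (nat \<lfloor>x * 2 ^ n\<rfloor>) \<le> x * 2 ^ n" "x * 2 ^ n - 1 \<le> real (nat \<lfloor>x * 2 ^ n\<rfloor>)"
    using of_int_floor_le[of "x * 2 ^ n"] real_of_int_floor_gt_diff_one[of "x * 2 ^ n"] by linarith+
  then show "dyadic_floor n x \<le> x" "x - (1/2) ^ n \<le> dyadic_floor n x"
    unfolding dyadic_floor_def
    by (simp_all add: pos_divide_le_eq pos_le_divide_eq left_diff_distrib power_divide del: of_nat_nat)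
qed

lemma dyadic_floor_tendsto:
  assumes "x \<ge> 0"
  shows "(\<lambda>n. dyadic_floor n x) \<longlonglongrightarrow> x"
proof (rule tendsto_sandwich[of "\<lambda>n. x - (1/2) ^ n" _ _ "\<lambda>_. x"])
  have "(\<lambda>n. x - (1/2) ^ n) \<longlonglongrightarrow> x - 0" by (intro tendsto_intros LIMSEQ_realpow_zero) auto
  then show "(\<lambda>n. x - (1/2) ^ n) \<longlonglongrightarrow> x" by simp
qed (use assms dyadic_floor_le dyadic_floor_ge in auto)

text \<open>Passing to the next dyadic level keeps the approximating point or moves it by one new
  cell, so chaining costs a single increment per level.\<close>

lemma nat_floor_double:
  assumes "y \<ge> (0::real)"
  shows "nat \<lfloor>2 * y\<rfloor> = 2 * nat \<lfloor>y\<rfloor> \<or> nat \<lfloor>2 * y\<rfloor> = Suc (2 * nat \<lfloor>y\<rfloor>)"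
proof -
  have "\<lfloor>2 * y\<rfloor> = 2 * \<lfloor>y\<rfloor> \<or> \<lfloor>2 * y\<rfloor> = 2 * \<lfloor>y\<rfloor> + 1" by linarith
  moreover have "\<lfloor>y\<rfloor> \<ge> 0" using assms by simp
  ultimately show ?thesis by linarith
qed

lemma nat_floor_scaled_le:
  fixes x :: real
  assumes "0 \<le> x" "x \<le> 2 ^ n"
  shows "nat \<lfloor>x * 2 ^ n\<rfloor> \<le> 4 ^ n"
proof -
  have "x * 2 ^ n \<le> 2 ^ n * 2 ^ n" using assms by (intro mult_right_mono) auto
  also have "\<dots> = real (4 ^ n)" by (simp add: power_mult_distrib[symmetric])
  finally show ?thesis by linarith
qed

text \<open>Here 4^n = 2^n * 2^n counts the cells of mesh 2^(-n) in [0, 2^n]. The threshold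
  \<open>n0\<close> may depend on the path, as Borel-Cantelli provides it; continuity carries bounds
  from dyadic points to all of [0, \<infinity>).\<close>

locale dyadic_control =
  fixes f :: "real \<Rightarrow> real" and q :: real and n0 :: nat
  assumes cont: "continuous_on {0..} f"
    and q_pos: "0 < q" and q_less_1: "q < 1"
    and incr: "\<And>n k. n \<ge> n0 \<Longrightarrow> k < 4 ^ n \<Longrightarrow> \<bar>f (real (Suc k) / 2 ^ n) - f (real k / 2 ^ n)\<bar> \<le> q ^ n"
begin

lemma refine_step:
  assumes "n \<ge> n0" "0 \<le> x" "x \<le> 2 ^ n"
  shows "\<bar>f (dyadic_floor (Suc n) x) - f (dyadic_floor n x)\<bar> \<le> q ^ Suc n"
proof -
  define k where "k = nat \<lfloor>x * 2 ^ n\<rfloor>"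
  have "k \<le> 4 ^ n" using nat_floor_scaled_le[of x n] assms unfolding k_def by simp
  \<comment> \<open>Even at the right end x = 2^n the cell is still covered, because level n + 1
    reaches twice as far.\<close>
  then have "2 * k < 4 ^ Suc n" by (simp add: order_le_less_trans)
  have "nat \<lfloor>2 * (x * 2 ^ n)\<rfloor> = 2 * k \<or> nat \<lfloor>2 * (x * 2 ^ n)\<rfloor> = Suc (2 * k)"
    unfolding k_def using assms by (intro nat_floor_double) simp
  moreover have "x * 2 ^ Suc n = 2 * (x * 2 ^ n)" by simp
  ultimately have "dyadic_floor (Suc n) x = real (2 * k) / 2 ^ Suc n \<or>
      dyadic_floor (Suc n) x = real (Suc (2 * k)) / 2 ^ Suc n"
    unfolding dyadic_floor_def by metis
  moreover have "dyadic_floor n x = real (2 * k) / 2 ^ Suc n"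
    unfolding dyadic_floor_def k_def by simp
  ultimately show ?thesis
    using incr[of "Suc n" "2 * k"] \<open>2 * k < 4 ^ Suc n\<close> assms(1) q_pos by auto
qed

text \<open>The geometric tail: \<open>q ^ n * c\<close> is the sum of q^i over all i > n.\<close>

abbreviation c :: real where "c \<equiv> q / (1 - q)"

lemma c_nonneg: "c \<ge> 0" using q_pos q_less_1 by simp

text \<open>The bound is the exact sum of q^i over n < i \<le> n + j; keeping the subtracted term
  lets the induction telescope.\<close>

lemma refine_steps:
  assumes "n \<ge> n0" "0 \<le> x" "x \<le> 2 ^ n"
  shows "\<bar>f (dyadic_floor (n + j) x) - f (dyadic_floor n x)\<bar> \<le> (q ^ n - q ^ (n + j)) * c"
proof (induction j)
  case (Suc j)
  have "x \<le> 2 ^ (n + j)" using order_trans[OF assms(3) power_increasing[of n "n + j" "2::real"]] by simp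
  then have "\<bar>f (dyadic_floor (Suc (n + j)) x) - f (dyadic_floor (n + j) x)\<bar> \<le> q ^ Suc (n + j)"
    using assms by (intro refine_step) auto
  moreover have "q ^ Suc (n + j) = (q ^ (n + j) - q ^ Suc (n + j)) * c"
    using q_less_1 by (simp add: field_simps)
  moreover have "(q ^ n - q ^ (n + j)) * c + (q ^ (n + j) - q ^ Suc (n + j)) * c = (q ^ n - q ^ (n + Suc j)) * c"
    by (simp only: add_Suc_right ring_distribs)
  ultimately show ?case using Suc.IH unfolding add_Suc_right by linarith
qed simp

lemma dyadic_floor_approx:
  assumes "n \<ge> n0" "0 \<le> x" "x \<le> 2 ^ n"
  shows "\<bar>f x - f (dyadic_floor n x)\<bar> \<le> q ^ n * c"
proof (rule LIMSEQ_le_const2)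
  have "(\<lambda>j. f (dyadic_floor j x)) \<longlonglongrightarrow> f x"
    by (rule continuous_on_tendsto_compose[OF cont dyadic_floor_tendsto])
       (use assms in \<open>auto simp: dyadic_floor_def\<close>)
  then have "(\<lambda>j. f (dyadic_floor (n + j) x)) \<longlonglongrightarrow> f x"
    using LIMSEQ_ignore_initial_segment[of _ _ n] by (simp add: add.commute)
  then show "(\<lambda>j. \<bar>f (dyadic_floor (n + j) x) - f (dyadic_floor n x)\<bar>) \<longlonglongrightarrow> \<bar>f x - f (dyadic_floor n x)\<bar>"
    by (intro tendsto_intros)
  show "\<exists>N. \<forall>j\<ge>N. \<bar>f (dyadic_floor (n + j) x) - f (dyadic_floor n x)\<bar> \<le> q ^ n * c"
  proof (intro exI allI impI)
    fix j
    have "(q ^ n - q ^ (n + j)) * c \<le> q ^ n * c"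
      using q_pos c_nonneg by (intro mult_right_mono) auto
    with refine_steps[OF assms, of j]
    show "\<bar>f (dyadic_floor (n + j) x) - f (dyadic_floor n x)\<bar> \<le> q ^ n * c" by linarith
  qed
qed

text \<open>Points at most one mesh apart have equal or adjacent level-n floors. This costs one grid
  increment, plus the distance to the floor at both ends, hence 1 + 2c.\<close>

lemma increment_bound:
  assumes "n \<ge> n0" "0 \<le> x" "x \<le> y" "y \<le> 2 ^ n" "y - x \<le> (1/2) ^ n"
  shows "\<bar>f y - f x\<bar> \<le> q ^ n * (1 + 2 * c)"
proof -
  define k l where "k = nat \<lfloor>x * 2 ^ n\<rfloor>" and "l = nat \<lfloor>y * 2 ^ n\<rfloor>"
  have "y * 2 ^ n \<le> x * 2 ^ n + 1" "x * 2 ^ n \<le> y * 2 ^ n"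
    using assms(3,5) by (simp_all add: field_simps power_divide)
  moreover have "0 \<le> x * 2 ^ n" using assms by simp
  ultimately have kl: "l = k \<or> l = Suc k" unfolding k_def l_def by linarith
  have "l \<le> 4 ^ n" unfolding l_def using nat_floor_scaled_le[of y n] assms by simp
  have "\<bar>f (dyadic_floor n y) - f (dyadic_floor n x)\<bar> \<le> q ^ n"
  proof (cases "l = k")
    case True
    then show ?thesis using q_pos unfolding dyadic_floor_def k_def l_def by simp
  next
    case False
    then have "l = Suc k" "k < 4 ^ n" using kl \<open>l \<le> 4 ^ n\<close> by auto
    then show ?thesis using incr[OF assms(1), of k] unfolding dyadic_floor_def k_def l_def by simp
  qed
  moreover have "\<bar>f x - f (dyadic_floor n x)\<bar> \<le> q ^ n * c" "\<bar>f y - f (dyadic_floor n y)\<bar> \<le> q ^ n * c"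
    using assms by (intro dyadic_floor_approx; simp)+
  moreover have "q ^ n * (1 + 2 * c) = q ^ n + q ^ n * c + q ^ n * c" by (simp add: algebra_simps)
  ultimately show ?thesis by linarith
qed

text \<open>For h = t - s between 2^(-n-1) and 2^(-n), the squared increment is at most K^2 q^(2n) =
  K^2 (2 q^2)^n 2^(-n), and 2^(-n) < 2h. Since 2 q^2 < 1, the factor in front of h tends to
  zero.\<close>

lemma little_half_holder:
  assumes "2 * q\<^sup>2 < 1"
  shows "little_half_holder f 0 T"
  unfolding little_half_holder_def
proof (intro allI impI)
  fix \<epsilon> :: real assume "\<epsilon> > 0"
  define K where "K = 1 + 2 * c"
  have "K > 0" using c_nonneg by (simp add: K_def add_pos_nonneg)
  obtain N where N: "T \<le> 2 ^ N" using real_arch_pow[of 2 T] by (auto intro: less_imp_le)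
  have "(\<lambda>n. (2 * q\<^sup>2) ^ n) \<longlonglongrightarrow> 0" using assms q_pos by (intro LIMSEQ_realpow_zero) auto
  then have "eventually (\<lambda>n. (2 * q\<^sup>2) ^ n < \<epsilon> / (2 * K\<^sup>2)) sequentially"
    using \<open>\<epsilon> > 0\<close> \<open>K > 0\<close> by (intro order_tendstoD) auto
  then obtain n1 where n1: "\<And>n. n \<ge> n1 \<Longrightarrow> (2 * q\<^sup>2) ^ n < \<epsilon> / (2 * K\<^sup>2)"
    unfolding eventually_sequentially by blast
  \<comment> \<open>Beyond \<open>n2\<close> three things hold: the factor (2 q^2)^n is small,
    [0, 2^n] contains [0, T], and the increment bound is in force.\<close>
  define n2 where "n2 = max n1 (max N n0)"
  show "\<exists>\<delta>>0. \<forall>s t. 0 \<le> s \<and> s \<le> t \<and> t \<le> T \<and> t - s < \<delta> \<longrightarrow> (f t - f s)\<^sup>2 \<le> \<epsilon> * (t - s)"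
  proof (intro exI[of _ "(1/2) ^ n2"] conjI allI impI)
    fix s t assume *: "0 \<le> s \<and> s \<le> t \<and> t \<le> T \<and> t - s < (1/2) ^ n2"
    show "(f t - f s)\<^sup>2 \<le> \<epsilon> * (t - s)"
    proof (cases "s = t")
      case False
      define h where "h = t - s"
      have "h > 0" "h < (1/2) ^ n2" using * False unfolding h_def by auto
      \<comment> \<open>The scale of h: minimality will give h \<le> 2^(-n), the defining property
        gives 2^(-n-1) < h.\<close>
      define n where "n = (LEAST n. (1/2) ^ Suc n < h)"
      have ex: "\<exists>n. (1/2) ^ Suc n < h"
      proof -
        obtain m where "(1/2::real) ^ m < h" using real_arch_pow_inv[OF \<open>h > 0\<close>, of "1/2"] by auto
        then have "(1/2) ^ Suc m < h" using zero_le_power[of "1/2::real" m] by (simp only: power_Suc) linarith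
        then show ?thesis ..
      qed
      have n_less: "(1/2) ^ Suc n < h" unfolding n_def using LeastI_ex[OF ex] .
      have "n \<ge> n2"
      proof (rule ccontr)
        assume "\<not> n2 \<le> n"
        then have "(1/2::real) ^ n2 \<le> (1/2) ^ Suc n" by (intro power_decreasing) auto
        with n_less \<open>h < (1/2) ^ n2\<close> show False by linarith
      qed
      have "h \<le> (1/2) ^ n"
      proof (cases n)
        \<comment> \<open>Minimality says nothing here, but n2 \<le> n forces n2 = 0 and hence h <
          1.\<close>
        case 0
        then show ?thesis using \<open>n \<ge> n2\<close> \<open>h < (1/2) ^ n2\<close> by simp
      next
        case (Suc m)
        then have "\<not> (1/2) ^ Suc m < h" using not_less_Least[of m "\<lambda>n. (1/2) ^ Suc n < h"] unfolding n_def by simp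
        then show ?thesis using Suc by simp
      qed
      have "(2::real) ^ N \<le> 2 ^ n" using \<open>n \<ge> n2\<close> unfolding n2_def by (intro power_increasing) auto
      then have "\<bar>f t - f s\<bar> \<le> q ^ n * K" unfolding K_def
        using * N \<open>n \<ge> n2\<close> \<open>h \<le> (1/2) ^ n\<close> unfolding n2_def h_def by (intro increment_bound) linarith+
      then have "(f t - f s)\<^sup>2 \<le> (q ^ n * K)\<^sup>2"
        using abs_le_square_iff[of "f t - f s" "q ^ n * K"] q_pos \<open>K > 0\<close> by simp
      also have "\<dots> = (2 * q\<^sup>2) ^ n * K\<^sup>2 * 2 * (1/2) ^ Suc n"
        by (simp add: power_mult_distrib power_divide power_mult[symmetric] mult.commute)
      also have "\<dots> \<le> \<epsilon> / (2 * K\<^sup>2) * K\<^sup>2 * 2 * h"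
        using n1[of n] n_less \<open>n \<ge> n2\<close> \<open>K > 0\<close> \<open>h > 0\<close> \<open>\<epsilon> > 0\<close> unfolding n2_def
        by (intro mult_mono) auto
      also have "\<dots> = \<epsilon> * h" using \<open>K > 0\<close> by simp
      finally show ?thesis by (simp add: h_def)
    qed simp
  qed simp
qed

text \<open>A crude count is enough: reaching x \<le> 2^n takes at most 4^n grid increments, each at
  most 1, and for the least such n beyond \<open>n0\<close> one has 4^n \<le> 4 x^2.\<close>

lemma quadratic_growth: "\<exists>C. \<forall>x\<ge>0. \<bar>f x\<bar> \<le> C * (1 + x\<^sup>2)"
proof -
  have grid: "\<bar>f (real k / 2 ^ n) - f 0\<bar> \<le> real k" if "n \<ge> n0" "k \<le> 4 ^ n" for n k
    using that(2)
  proof (induction k)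
    case (Suc k)
    have "q ^ n \<le> 1" using q_pos q_less_1 by (intro power_le_one) auto
    then show ?case using Suc incr[of n k] that(1) by simp
  qed simp
  have dyadic: "\<bar>f x\<bar> \<le> \<bar>f 0\<bar> + c + 4 ^ n" if "n \<ge> n0" "0 \<le> x" "x \<le> 2 ^ n" for n x
  proof -
    have "nat \<lfloor>x * 2 ^ n\<rfloor> \<le> 4 ^ n" using nat_floor_scaled_le[of x n] that by simp
    then have "real (nat \<lfloor>x * 2 ^ n\<rfloor>) \<le> 4 ^ n" by (metis of_nat_le_iff of_nat_numeral of_nat_power)
    then have "\<bar>f (dyadic_floor n x) - f 0\<bar> \<le> 4 ^ n"
      using grid[OF that(1) \<open>nat \<lfloor>x * 2 ^ n\<rfloor> \<le> 4 ^ n\<close>] unfolding dyadic_floor_def by linarith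
    moreover have "q ^ n * c \<le> 1 * c"
      using q_pos q_less_1 c_nonneg by (intro mult_right_mono power_le_one) auto
    ultimately show ?thesis using dyadic_floor_approx[OF that] by linarith
  qed
  \<comment> \<open>The terms with \<open>n0\<close> cover x \<le> 2^n0; the extra 4 absorbs 4^n
    \<le> 4 x^2 beyond it.\<close>
  define C where "C = \<bar>f 0\<bar> + c + 4 ^ n0 + 4"
  have "C \<ge> 4" using c_nonneg by (simp add: C_def)
  have "\<bar>f x\<bar> \<le> C * (1 + x\<^sup>2)" if "x \<ge> 0" for x
  proof (cases "x \<le> 2 ^ n0")
    case True
    then have "\<bar>f x\<bar> \<le> C * 1" using dyadic[of n0 x] that unfolding C_def by simp
    also have "\<dots> \<le> C * (1 + x\<^sup>2)" using \<open>C \<ge> 4\<close> by (intro mult_left_mono) auto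
    finally show ?thesis .
  next
    case False
    define n where "n = (LEAST n. x \<le> 2 ^ n)"
    have ex: "\<exists>n. x \<le> 2 ^ n" using real_arch_pow[of 2 x] by (auto intro: less_imp_le)
    have n: "x \<le> 2 ^ n" unfolding n_def using LeastI_ex[OF ex] .
    have "n > n0"
    proof (rule ccontr)
      assume "\<not> n0 < n"
      then have "(2::real) ^ n \<le> 2 ^ n0" by (intro power_increasing) auto
      with n False show False by linarith
    qed
    then obtain m where m: "n = Suc m" by (cases n) auto
    then have "\<not> x \<le> 2 ^ m" using not_less_Least[of m "\<lambda>n. x \<le> 2 ^ n"] unfolding n_def by simp
    then have "(2 ^ m)\<^sup>2 \<le> x\<^sup>2" by (intro power_mono) auto
    then have "4 ^ m \<le> x\<^sup>2" by (simp add: power2_eq_square power_mult_distrib[symmetric])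
    then have "4 ^ n \<le> 4 * x\<^sup>2" using m by simp
    moreover have "\<bar>f x\<bar> \<le> \<bar>f 0\<bar> + c + 4 ^ n" using dyadic[of n x] n \<open>n > n0\<close> that by simp
    moreover have "(0::real) \<le> 4 ^ n0" by simp
    ultimately have "\<bar>f x\<bar> \<le> (C - 4) + 4 * x\<^sup>2" unfolding C_def by linarith
    also have "\<dots> \<le> C + C * x\<^sup>2" using \<open>C \<ge> 4\<close> by (intro add_mono mult_right_mono) auto
    finally show ?thesis by (simp add: algebra_simps)
  qed
  then show ?thesis by blast
qed

end

section \<open>Pathwise analysis of the estimator\<close>

text \<open>Past some r the integrand exceeds z^2/2, so the integral grows at least
  linearly.\<close>

lemma integral_square_at_top:
  fixes Z :: "real \<Rightarrow> real"
  assumes cont: "continuous_on {0..} Z" and lim: "(Z \<longlongrightarrow> z) at_top" and "z \<noteq> 0"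
  shows "filterlim (\<lambda>T. integral {0..T} (\<lambda>s. (Z s)\<^sup>2)) at_top at_top"
proof -
  have "((\<lambda>s. (Z s)\<^sup>2) \<longlongrightarrow> z\<^sup>2) at_top" by (intro tendsto_intros lim)
  moreover have "z\<^sup>2 / 2 < z\<^sup>2" using \<open>z \<noteq> 0\<close> by simp
  ultimately have "eventually (\<lambda>s. z\<^sup>2 / 2 < (Z s)\<^sup>2) at_top" by (rule order_tendstoD)
  then obtain t0 where t0: "\<And>s. s \<ge> t0 \<Longrightarrow> z\<^sup>2 / 2 < (Z s)\<^sup>2" unfolding eventually_at_top_linorder by blast
  define r where "r = max 0 t0"
  have int: "(\<lambda>s. (Z s)\<^sup>2) integrable_on {u..v}" if "u \<ge> 0" for u v
    using that by (intro integrable_continuous_interval continuous_intros continuous_on_subset[OF cont]) auto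
  have "z\<^sup>2 / 2 * (T - r) \<le> integral {0..T} (\<lambda>s. (Z s)\<^sup>2)" if "T \<ge> r" for T
  proof -
    have "z\<^sup>2 / 2 * (T - r) = integral {r..T} (\<lambda>_. z\<^sup>2 / 2)" using that by simp
    also have "\<dots> \<le> integral {r..T} (\<lambda>s. (Z s)\<^sup>2)"
    proof (rule integral_le)
      fix s assume "s \<in> {r..T}"
      then show "z\<^sup>2 / 2 \<le> (Z s)\<^sup>2" using t0[of s] unfolding r_def by simp
    qed (auto intro!: int simp: r_def)
    also have "\<dots> \<le> integral {0..T} (\<lambda>s. (Z s)\<^sup>2)"
      by (intro integral_subset_le int) (auto simp: r_def)
    finally show ?thesis .
  qed
  then have "eventually (\<lambda>T. z\<^sup>2 / 2 * (T - r) \<le> integral {0..T} (\<lambda>s. (Z s)\<^sup>2)) at_top"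
    unfolding eventually_at_top_linorder by blast
  moreover have "filterlim (\<lambda>T. z\<^sup>2 / 2 * (T - r)) at_top at_top"
  proof (rule filterlim_tendsto_pos_mult_at_top[OF tendsto_const])
    show "filterlim (\<lambda>T. T - r) at_top at_top"
      using filterlim_tendsto_add_at_top[OF tendsto_const[of "-r"] filterlim_ident] by simp
  qed (use \<open>z \<noteq> 0\<close> in simp)
  ultimately show ?thesis by (rule filterlim_at_top_mono[rotated])
qed

text \<open>Domination by an exponential makes h absolutely integrable on the half-line; convergence
  of the truncations is then a Lebesgue statement, translated back on each [0, T].\<close>

lemma integral_exp_decay_converges:
  fixes h :: "real \<Rightarrow> real"
  assumes cont: "continuous_on {0..} h" and "\<eta> > 0" and bound: "\<And>s. s \<ge> 0 \<Longrightarrow> \<bar>h s\<bar> \<le> C * exp (- \<eta> * s)"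
  shows "\<exists>l. ((\<lambda>T. integral {0..T} h) \<longlongrightarrow> l) at_top"
proof -
  have int: "((\<lambda>s. C * exp (- \<eta> * s)) has_integral C / \<eta>) {0..}"
    using has_integral_mult_right[OF has_integral_exp_minus_to_infinity[OF \<open>\<eta> > 0\<close>, of 0], of C] by simp
  have "h absolutely_integrable_on {0..}"
  proof (rule measurable_bounded_by_integrable_imp_absolutely_integrable)
    show "h \<in> borel_measurable (lebesgue_on {0..})"
      by (rule continuous_imp_measurable_on_sets_lebesgue[OF cont]) auto
  qed (use int bound in \<open>auto simp: has_integral_integrable\<close>)
  moreover have "(\<lambda>x. indicat_real {0..} x *\<^sub>R h x) \<in> borel_measurable lborel"
    using borel_measurable_continuous_on_indicator[of "{0..}" h] cont by simp
  ultimately have "set_integrable lborel {0..} h"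
    unfolding set_integrable_def using integrable_completion by blast
  from tendsto_set_lebesgue_integral_at_top[where a = 0 and f = h, OF _ this]
  have "((\<lambda>T. LINT x:{0..T}|lborel. h x) \<longlongrightarrow> (LINT x:{0..}|lborel. h x)) at_top" by simp
  moreover have "(LINT x:{0..T}|lborel. h x) = integral {0..T} h" for T
    by (intro set_borel_integral_eq_integral(2) borel_integrable_atLeastAtMost'
          continuous_on_subset[OF cont]) auto
  ultimately show ?thesis by auto
qed

lemma weighted_square: "exp (- 2 * \<theta> * s) * (exp (\<theta> * s) * (z::real))\<^sup>2 = z\<^sup>2"
proof -
  have "exp (- 2 * \<theta> * s) * (exp (\<theta> * s))\<^sup>2 = 1"
    by (simp add: exp_double[symmetric] mult_exp_exp)
  then show ?thesis by (simp add: power_mult_distrib mult.assoc[symmetric])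
qed

text \<open>What is used of a single path. Inside this locale the argument is deterministic; the
  nonvanishing of the limit of Z is supplied from outside.\<close>

locale ou_path =
  fixes b :: "real \<Rightarrow> real" and \<theta> :: real
  assumes \<theta>_pos: "\<theta> > 0"
    and b_cont: "continuous_on {0..} b"
    and b_0: "b 0 = 0"
    and b_holder: "\<And>T. little_half_holder b 0 T"
    and b_growth: "\<exists>C. \<forall>x\<ge>0. \<bar>b x\<bar> \<le> C * (1 + x\<^sup>2)"
begin

definition J :: "real \<Rightarrow> real" where
  "J t = integral {0..t} (\<lambda>u. exp (- \<theta> * u) * b u)"

definition Z :: "real \<Rightarrow> real" where
  "Z t = exp (- \<theta> * t) * b t + \<theta> * J t"

lemma J_deriv:
  assumes "x \<in> {0..T}"
  shows "(J has_real_derivative exp (- \<theta> * x) * b x) (at x within {0..T})"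
  unfolding J_def
  by (intro integral_has_real_derivative assms continuous_intros continuous_on_subset[OF b_cont]) auto

lemma J_cont: "continuous_on {0..T} J"
  by (rule DERIV_continuous_on[OF J_deriv])

lemma Z_cont: "continuous_on {0..} Z"
proof -
  show ?thesis
    unfolding continuous_on_eq_continuous_within
  proof
    fix x :: real assume "x \<in> {0..}"
    \<comment> \<open>Continuity of J is known on compact intervals only; near x, [0, x + 1] and the
      half-line coincide.\<close>
    have "continuous_on {0..x + 1} Z"
      unfolding Z_def by (intro continuous_intros J_cont continuous_on_subset[OF b_cont]) auto
    then have "continuous (at x within {0..x + 1}) Z"
      using \<open>x \<in> {0..}\<close> by (simp add: continuous_on_eq_continuous_within)
    moreover have "at x within {0..x + 1} = at x within {0..}"
      by (rule at_within_nhd[of _ "{x - 1<..<x + 1}"]) auto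
    ultimately show "continuous (at x within {0..}) Z" by simp
  qed
qed

lemma Z_RS:
  assumes "T \<ge> 0"
  shows "has_RS_integral (\<lambda>s. exp (- \<theta> * s)) b 0 T (Z T)"
proof -
  have "has_RS_integral (\<lambda>s. exp (- \<theta> * s)) b 0 T
      (exp (- \<theta> * T) * b T - exp (- \<theta> * 0) * b 0 - integral {0..T} (\<lambda>u. (- \<theta> * exp (- \<theta> * u)) * b u))"
  proof (rule has_RS_integral_by_parts)
    fix x show "((\<lambda>s. exp (- \<theta> * s)) has_real_derivative - \<theta> * exp (- \<theta> * x)) (at x within {0..T})"
      by (auto intro!: derivative_eq_intros)
    show "continuous_on {0..T} (\<lambda>x. - \<theta> * exp (- \<theta> * x))" by (intro continuous_intros)
    show "continuous_on {0..T} b" by (rule continuous_on_subset[OF b_cont]) auto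
  qed
  moreover have "integral {0..T} (\<lambda>u. (- \<theta> * exp (- \<theta> * u)) * b u) = - \<theta> * J T"
    unfolding J_def mult.assoc by (rule integral_mult_right)
  ultimately show ?thesis by (simp add: b_0 Z_def)
qed

text \<open>X is b plus a C1 drift, so it inherits the little 1/2-Hoelder condition. In the chain
  rule with weight w s = exp (-2\<theta>s), the derivative w' = -2\<theta> w is what produces
  \<theta> times the denominator.\<close>

lemma numerator_has_RS_integral:
  assumes "T \<ge> 0" and X: "\<And>s. s \<ge> 0 \<Longrightarrow> X s = exp (\<theta> * s) * Z s"
  shows "has_RS_integral (\<lambda>s. exp (- 2 * \<theta> * s) * X s) X 0 T
     ((Z T)\<^sup>2 / 2 + \<theta> * integral {0..T} (\<lambda>s. (Z s)\<^sup>2))"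
proof -
  have X': "X s = b s + \<theta> * exp (\<theta> * s) * J s" if "s \<ge> 0" for s
    unfolding X[OF that] Z_def by (simp add: algebra_simps exp_minus)
  have "continuous_on {0..T} (\<lambda>s. exp (\<theta> * s) * Z s)"
    by (intro continuous_intros continuous_on_subset[OF Z_cont]) auto
  then have contX: "continuous_on {0..T} X"
    by (rule continuous_on_cong[THEN iffD1, rotated -1]) (auto simp: X)
  \<comment> \<open>The derivative below equals \<theta> X, in accordance with the equation for
    X.\<close>
  have "little_half_holder (\<lambda>s. \<theta> * exp (\<theta> * s) * J s) 0 T"
  proof (rule little_half_holder_C1[where f' = "\<lambda>x. \<theta> * \<theta> * exp (\<theta> * x) * J x + \<theta> * exp (\<theta> * x) * (exp (- \<theta> * x) * b x)"])
    fix x assume "x \<in> {0..T}"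
    then show "((\<lambda>s. \<theta> * exp (\<theta> * s) * J s) has_real_derivative
        (\<theta> * \<theta> * exp (\<theta> * x) * J x + \<theta> * exp (\<theta> * x) * (exp (- \<theta> * x) * b x))) (at x within {0..T})"
      by (auto intro!: derivative_eq_intros J_deriv)
  next
    show "continuous_on {0..T} (\<lambda>x. \<theta> * \<theta> * exp (\<theta> * x) * J x + \<theta> * exp (\<theta> * x) * (exp (- \<theta> * x) * b x))"
      by (intro continuous_intros J_cont continuous_on_subset[OF b_cont]) auto
  qed
  then have "little_half_holder (\<lambda>s. b s + \<theta> * exp (\<theta> * s) * J s) 0 T"
    by (intro little_half_holder_add b_holder)
  then have "little_half_holder X 0 T"
    by (rule little_half_holder_cong[rotated]) (use X' in auto)
  then have "has_RS_integral (\<lambda>s. exp (- 2 * \<theta> * s) * X s) X 0 T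
     (exp (- 2 * \<theta> * T) * (X T)\<^sup>2 / 2 - exp (- 2 * \<theta> * 0) * (X 0)\<^sup>2 / 2
       - integral {0..T} (\<lambda>u. (- 2 * \<theta> * exp (- 2 * \<theta> * u)) * (X u)\<^sup>2) / 2)"
  proof (intro has_RS_integral_chain_rule contX)
    fix x show "((\<lambda>s. exp (- 2 * \<theta> * s)) has_real_derivative - 2 * \<theta> * exp (- 2 * \<theta> * x)) (at x within {0..T})"
      by (auto intro!: derivative_eq_intros)
    show "continuous_on {0..T} (\<lambda>x. - 2 * \<theta> * exp (- 2 * \<theta> * x))" by (intro continuous_intros)
  qed
  moreover have "integral {0..T} (\<lambda>u. (- 2 * \<theta> * exp (- 2 * \<theta> * u)) * (X u)\<^sup>2)
      = integral {0..T} (\<lambda>u. (- 2 * \<theta>) * (Z u)\<^sup>2)"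
  proof (rule integral_cong)
    fix u assume "u \<in> {0..T}"
    then have "exp (- 2 * \<theta> * u) * (X u)\<^sup>2 = (Z u)\<^sup>2"
      using weighted_square X by simp
    then show "(- 2 * \<theta> * exp (- 2 * \<theta> * u)) * (X u)\<^sup>2 = (- 2 * \<theta>) * (Z u)\<^sup>2"
      by simp
  qed
  moreover have "exp (- 2 * \<theta> * T) * (X T)\<^sup>2 = (Z T)\<^sup>2" using weighted_square X assms(1) by simp
  moreover have "X 0 = 0" using X[of 0] by (simp add: Z_def J_def b_0)
  ultimately show ?thesis by simp
qed

lemma Z_converges: "\<exists>z. (Z \<longlongrightarrow> z) at_top"
proof -
  obtain C where C: "\<And>x. x \<ge> 0 \<Longrightarrow> \<bar>b x\<bar> \<le> C * (1 + x\<^sup>2)" using b_growth by blast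
  have "C \<ge> 0" using C[of 0] by simp
  \<comment> \<open>Half of the discount rate is spent on beating the quadratic growth of b; the
    other half is left for integrability.\<close>
  define \<eta> where "\<eta> = \<theta> / 2"
  have "\<eta> > 0" using \<theta>_pos by (simp add: \<eta>_def)
  \<comment> \<open>From 1 \<le> exp (\<eta>s) and s^2 \<le> (2/\<eta>^2) exp (\<eta>s), the latter
    by the quadratic Taylor bound.\<close>
  define D where "D = C * (1 + 2 / \<eta>\<^sup>2)"
  have bound: "\<bar>exp (- \<theta> * s) * b s\<bar> \<le> D * exp (- \<eta> * s)" if "s \<ge> 0" for s
  proof -
    have "1 + \<eta> * s + (\<eta> * s)\<^sup>2 / 2 \<le> exp (\<eta> * s)"
      using \<open>\<eta> > 0\<close> that by (intro exp_lower_Taylor_quadratic) simp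
    moreover have "0 \<le> \<eta> * s" using \<open>\<eta> > 0\<close> that by simp
    ultimately have "1 \<le> exp (\<eta> * s)" "(\<eta> * s)\<^sup>2 / 2 \<le> exp (\<eta> * s)"
      using zero_le_power2[of "\<eta> * s"] by linarith+
    then have "1 + s\<^sup>2 \<le> exp (\<eta> * s) + 2 / \<eta>\<^sup>2 * exp (\<eta> * s)"
      using \<open>\<eta> > 0\<close> by (intro add_mono) (auto simp: field_simps)
    then have "C * (1 + s\<^sup>2) \<le> C * ((1 + 2 / \<eta>\<^sup>2) * exp (\<eta> * s))"
      using \<open>C \<ge> 0\<close> by (intro mult_left_mono) (auto simp: algebra_simps)
    then have "\<bar>b s\<bar> \<le> D * exp (\<eta> * s)" using C[OF that] unfolding D_def by (simp add: mult.assoc)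
    then have "exp (- \<theta> * s) * \<bar>b s\<bar> \<le> exp (- \<theta> * s) * (D * exp (\<eta> * s))" by (intro mult_left_mono) auto
    also have "\<dots> = D * exp (- \<eta> * s)"
      unfolding \<eta>_def by (simp add: mult.left_commute mult_exp_exp)
    finally show ?thesis by (simp add: abs_mult)
  qed
  have "\<exists>l. ((\<lambda>T. integral {0..T} (\<lambda>s. exp (- \<theta> * s) * b s)) \<longlongrightarrow> l) at_top"
    by (rule integral_exp_decay_converges[OF _ \<open>\<eta> > 0\<close> bound])
       (auto intro!: continuous_intros continuous_on_subset[OF b_cont])
  then obtain l where "(J \<longlongrightarrow> l) at_top" unfolding J_def[abs_def] by blast
  moreover have "((\<lambda>s. exp (- \<theta> * s) * b s) \<longlongrightarrow> 0) at_top"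
  proof (rule Lim_null_comparison)
    show "eventually (\<lambda>s. norm (exp (- \<theta> * s) * b s) \<le> D * exp (- \<eta> * s)) at_top"
      using eventually_ge_at_top[of 0] by eventually_elim (use bound in auto)
    have "((\<lambda>s. D * exp (- \<eta> * s)) \<longlongrightarrow> D * 0) at_top"
      using \<open>\<eta> > 0\<close>
      by (intro tendsto_intros filterlim_compose[OF exp_at_bot])
         (rule filterlim_tendsto_neg_mult_at_bot[OF tendsto_const _ filterlim_ident], simp)
    then show "((\<lambda>s. D * exp (- \<eta> * s)) \<longlongrightarrow> 0) at_top" by simp
  qed
  ultimately have "(Z \<longlongrightarrow> 0 + \<theta> * l) at_top" unfolding Z_def[abs_def] by (intro tendsto_intros)
  then show ?thesis by blast
qed

lemma estimator_tendsto:
  assumes X: "\<And>s. s \<ge> 0 \<Longrightarrow> X s = exp (\<theta> * s) * Z s" and z: "(Z \<longlongrightarrow> z) at_top" "z \<noteq> 0"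
  shows "((\<lambda>T. RS_integral (\<lambda>s. exp (- 2 * \<theta> * s) * X s) X 0 T
           / integral {0..T} (\<lambda>s. exp (- 2 * \<theta> * s) * (X s)\<^sup>2)) \<longlongrightarrow> \<theta>) at_top"
proof -
  define D where "D T = integral {0..T} (\<lambda>s. (Z s)\<^sup>2)" for T
  have D: "filterlim D at_top at_top"
    unfolding D_def[abs_def] by (rule integral_square_at_top[OF Z_cont z])
  have "((\<lambda>T. ((Z T)\<^sup>2 / 2) / D T) \<longlongrightarrow> 0) at_top"
    by (rule tendsto_divide_0[of _ "z\<^sup>2 / 2", OF _ filterlim_at_top_imp_at_infinity[OF D]])
       (intro tendsto_intros z(1), simp)
  then have lim: "((\<lambda>T. ((Z T)\<^sup>2 / 2) / D T + \<theta>) \<longlongrightarrow> 0 + \<theta>) at_top" by (intro tendsto_intros)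
  \<comment> \<open>Only eventually: identifying \<open>RS_integral\<close> needs T \<ge> 0, and
    cancelling the denominator needs D T > 0.\<close>
  have ev: "eventually (\<lambda>T. ((Z T)\<^sup>2 / 2) / D T + \<theta> = RS_integral (\<lambda>s. exp (- 2 * \<theta> * s) * X s) X 0 T
           / integral {0..T} (\<lambda>s. exp (- 2 * \<theta> * s) * (X s)\<^sup>2)) at_top"
    using eventually_ge_at_top[of 0] filterlim_at_top_dense[THEN iffD1, OF D, rule_format, of 0]
  proof eventually_elim
    case (elim T)
    have "integral {0..T} (\<lambda>s. exp (- 2 * \<theta> * s) * (X s)\<^sup>2) = D T"
      unfolding D_def by (intro integral_cong) (use weighted_square X in auto)
    then show ?case
      using RS_integral_eq[OF elim(1) numerator_has_RS_integral[OF elim(1) X]] elim(2)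
      by (simp add: D_def[symmetric] field_simps)
  qed
  show ?thesis using Lim_transform_eventually[OF lim ev] by (simp only: add_0_left)
qed

end

section \<open>Gaussian estimates\<close>

text \<open>The absolute value is convex and powr is increasing on nonnegative numbers, so
  nonnegative arguments suffice. If one of these is 0, the claim reduces to \<open>s powr p\<close>
  \<le> s for 0 < s < 1.\<close>

lemma convex_on_abs_powr:
  fixes p :: real
  assumes "p \<ge> 1"
  shows "convex_on UNIV (\<lambda>x. \<bar>x\<bar> powr p)"
proof (rule convex_onI)
  have pos: "((1 - t) * x + t * y) powr p \<le> (1 - t) * x powr p + t * y powr p"
    if t: "0 < t" "t < 1" and xy: "x \<ge> 0" "y \<ge> 0" for t x y :: real
  proof -
    have scale: "(s * z) powr p \<le> s * z powr p" if "0 < s" "s < 1" "z \<ge> 0" for s z :: real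
    proof -
      have "s powr p \<le> s powr 1" using that assms by (intro powr_mono') auto
      then have "s powr p * z powr p \<le> s * z powr p" using that by (intro mult_right_mono) auto
      then show ?thesis using that by (simp add: powr_mult)
    qed
    consider "x = 0" | "y = 0" | "x > 0" "y > 0" using xy by linarith
    then show ?thesis
    proof cases
      case 3
      then show ?thesis using convex_onD[OF powr_convex[OF assms], of t x y] t by simp
    qed (use scale[of t y] scale[of "1 - t" x] t xy in auto)
  qed
  fix t x y :: real assume t: "0 < t" "t < 1"
  have "\<bar>(1 - t) *\<^sub>R x + t *\<^sub>R y\<bar> \<le> (1 - t) * \<bar>x\<bar> + t * \<bar>y\<bar>"
    using abs_triangle_ineq[of "(1 - t) * x" "t * y"] t by (simp add: abs_mult)
  then have "\<bar>(1 - t) *\<^sub>R x + t *\<^sub>R y\<bar> powr p \<le> ((1 - t) * \<bar>x\<bar> + t * \<bar>y\<bar>) powr p"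
    using assms by (intro powr_mono2) auto
  also have "\<dots> \<le> (1 - t) * \<bar>x\<bar> powr p + t * \<bar>y\<bar> powr p" using t by (intro pos) auto
  finally show "\<bar>(1 - t) *\<^sub>R x + t *\<^sub>R y\<bar> powr p \<le> (1 - t) * \<bar>x\<bar> powr p + t * \<bar>y\<bar> powr p" .
qed simp

text \<open>The points x and x + u - v lie between x - v and x + u and have the same sum. With l =
  u/(u + v) they are convex combinations of the outer points with complementary weights, so adding
  the two inequalities removes l.\<close>

lemma convex_on_spread:
  fixes \<phi> :: "real \<Rightarrow> real"
  assumes "convex_on UNIV \<phi>" "u \<ge> 0" "v \<ge> 0"
  shows "\<phi> (x + u - v) + \<phi> x \<le> \<phi> (x + u) + \<phi> (x - v)"
proof (cases "u + v = 0")
  case True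
  then have "u = 0" "v = 0" using assms by auto
  then show ?thesis by simp
next
  case False
  then have "u + v > 0" using assms by auto
  define l where "l = u / (u + v)"
  have l: "0 \<le> l" "l \<le> 1" "l * (u + v) = u" using \<open>u + v > 0\<close> assms by (auto simp: l_def)
  have "(1 - l) * (x - v) + l * (x + u) = x - v + l * (u + v)" by (simp add: algebra_simps)
  moreover have "(1 - l) * (x + u) + l * (x - v) = x + u - l * (u + v)" by (simp add: algebra_simps)
  ultimately have "\<phi> (x + u - v) \<le> (1 - l) * \<phi> (x - v) + l * \<phi> (x + u)"
    "\<phi> x \<le> (1 - l) * \<phi> (x + u) + l * \<phi> (x - v)"
    using convex_onD[OF assms(1), of l "x - v" "x + u"] convex_onD[OF assms(1), of l "x + u" "x - v"] l
    by (simp_all add: algebra_simps)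
  then show ?thesis by (simp add: algebra_simps)
qed

context prob_space
begin

text \<open>The constant is the double factorial (2k - 1)!!. Writing the moment through the variance
  treats the degenerate and the nondegenerate Gaussian alike.\<close>

lemma gaussian_even_moment:
  assumes Y: "centered_gaussian M Y" and "k > 0"
  shows "integrable M (\<lambda>\<omega>. Y \<omega> ^ (2 * k))"
    and "expectation (\<lambda>\<omega>. Y \<omega> ^ (2 * k)) = fact (2 * k) / (2 ^ k * fact k) * expectation (\<lambda>\<omega>. (Y \<omega>)\<^sup>2) ^ k"
proof -
  have [measurable]: "Y \<in> borel_measurable M" using Y unfolding centered_gaussian_def by simp
  have "integrable M (\<lambda>\<omega>. Y \<omega> ^ (2 * k)) \<and>
    expectation (\<lambda>\<omega>. Y \<omega> ^ (2 * k)) = fact (2 * k) / (2 ^ k * fact k) * expectation (\<lambda>\<omega>. (Y \<omega>)\<^sup>2) ^ k"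
  proof (cases "AE \<omega> in M. Y \<omega> = 0")
    case True
    then have ae: "AE \<omega> in M. Y \<omega> ^ (2 * k) = 0" "AE \<omega> in M. (Y \<omega>)\<^sup>2 = 0"
      using \<open>k > 0\<close> by (auto elim!: eventually_mono)
    have "integrable M (\<lambda>\<omega>. Y \<omega> ^ (2 * k)) \<longleftrightarrow> integrable M (\<lambda>_. 0::real)"
      by (rule integrable_cong_AE) (use ae in auto)
    moreover have "expectation (\<lambda>\<omega>. Y \<omega> ^ (2 * k)) = expectation (\<lambda>_. 0::real)"
      by (rule integral_cong_AE) (use ae in auto)
    moreover have "expectation (\<lambda>\<omega>. (Y \<omega>)\<^sup>2) = expectation (\<lambda>_. 0::real)"
      by (rule integral_cong_AE) (use ae in auto)
    ultimately show ?thesis using \<open>k > 0\<close> by simp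
  next
    case False
    then obtain \<sigma> where "\<sigma> > 0" and D: "distributed M lborel Y (\<lambda>x. ennreal (normal_density 0 \<sigma> x))"
      using Y unfolding centered_gaussian_def by auto
    have mom: "integrable M (\<lambda>\<omega>. Y \<omega> ^ (2 * j))"
      "expectation (\<lambda>\<omega>. Y \<omega> ^ (2 * j)) = fact (2 * j) / ((2 / \<sigma>\<^sup>2) ^ j * fact j)" for j
      using normal_moment_even[OF \<open>\<sigma> > 0\<close>, of 0 j]
        distributed_integrable[OF D, of "\<lambda>x. x ^ (2 * j)"] distributed_integral[OF D, of "\<lambda>x. x ^ (2 * j)"]
      by (auto simp: has_bochner_integral_iff)
    have "expectation (\<lambda>\<omega>. (Y \<omega>)\<^sup>2) = \<sigma>\<^sup>2" using mom(2)[of 1] by (simp add: fact_numeral)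
    then show ?thesis using mom[of k] by (simp add: power_divide)
  qed
  then show "integrable M (\<lambda>\<omega>. Y \<omega> ^ (2 * k))"
    "expectation (\<lambda>\<omega>. Y \<omega> ^ (2 * k)) = fact (2 * k) / (2 ^ k * fact k) * expectation (\<lambda>\<omega>. (Y \<omega>)\<^sup>2) ^ k"
    by auto
qed

text \<open>Markov's inequality for the moment of order 2k. The order stays free so that the ratio
  of variance to a^2 can be raised to any power.\<close>

lemma gaussian_tail:
  assumes Y: "centered_gaussian M Y" and "k > 0" "a > 0"
  shows "prob {\<omega> \<in> space M. a < \<bar>Y \<omega>\<bar>}
    \<le> fact (2 * k) / (2 ^ k * fact k) * (expectation (\<lambda>\<omega>. (Y \<omega>)\<^sup>2) / a\<^sup>2) ^ k"
proof -
  have [measurable]: "Y \<in> borel_measurable M" using Y unfolding centered_gaussian_def by simp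
  have "prob {\<omega> \<in> space M. a < \<bar>Y \<omega>\<bar>} \<le> prob {\<omega> \<in> space M. a ^ (2 * k) \<le> Y \<omega> ^ (2 * k)}"
  proof (rule finite_measure_mono)
    show "{\<omega> \<in> space M. a < \<bar>Y \<omega>\<bar>} \<subseteq> {\<omega> \<in> space M. a ^ (2 * k) \<le> Y \<omega> ^ (2 * k)}"
    proof safe
      fix \<omega> assume "a < \<bar>Y \<omega>\<bar>"
      then have "a ^ (2 * k) \<le> \<bar>Y \<omega>\<bar> ^ (2 * k)" using \<open>a > 0\<close> by (intro power_mono) auto
      then show "a ^ (2 * k) \<le> Y \<omega> ^ (2 * k)" by (simp add: power_even_abs)
    qed
  qed measurable
  also have "\<dots> \<le> expectation (\<lambda>\<omega>. Y \<omega> ^ (2 * k)) / a ^ (2 * k)"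
    by (rule integral_Markov_inequality_measure[where A = "{}"])
       (use \<open>a > 0\<close> gaussian_even_moment(1)[OF Y \<open>k > 0\<close>] in \<open>auto simp: zero_le_even_power\<close>)
  also have "\<dots> = fact (2 * k) / (2 ^ k * fact k) * (expectation (\<lambda>\<omega>. (Y \<omega>)\<^sup>2) / a\<^sup>2) ^ k"
    unfolding gaussian_even_moment(2)[OF Y \<open>k > 0\<close>] by (simp add: power_divide power_mult)
  finally show ?thesis .
qed

text \<open>The density is at most 1/\<sigma> \<le> 1/s and the interval has length 2\<epsilon>. The
  positive lower bound on the variance excludes the degenerate alternative.\<close>

lemma gaussian_small_ball:
  assumes Y: "centered_gaussian M Y" and s: "s > 0" "s\<^sup>2 \<le> expectation (\<lambda>\<omega>. (Y \<omega>)\<^sup>2)" and "\<epsilon> > 0"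
  shows "prob {\<omega> \<in> space M. \<bar>Y \<omega>\<bar> < \<epsilon>} \<le> 2 * \<epsilon> / s"
proof -
  have [measurable]: "Y \<in> borel_measurable M" using Y unfolding centered_gaussian_def by simp
  have "\<not> (AE \<omega> in M. Y \<omega> = 0)"
  proof
    assume "AE \<omega> in M. Y \<omega> = 0"
    then have "expectation (\<lambda>\<omega>. (Y \<omega>)\<^sup>2) = expectation (\<lambda>_. 0::real)"
      by (intro integral_cong_AE) (auto elim!: eventually_mono)
    then show False using s zero_less_power[of s 2] by simp
  qed
  then obtain \<sigma> where "\<sigma> > 0" and D: "distributed M lborel Y (\<lambda>x. ennreal (normal_density 0 \<sigma> x))"
    using Y unfolding centered_gaussian_def by auto
  have "expectation (\<lambda>\<omega>. (Y \<omega>)\<^sup>2) = \<sigma>\<^sup>2"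
    using normal_moment_even[OF \<open>\<sigma> > 0\<close>, of 0 1] distributed_integral[OF D, of "\<lambda>x. x\<^sup>2"]
    by (auto simp: has_bochner_integral_iff fact_numeral)
  then have "s \<le> \<sigma>" using s \<open>\<sigma> > 0\<close> power2_le_imp_le[of s \<sigma>] by simp
  have dens: "normal_density 0 \<sigma> x \<le> 1 / s" for x
  proof -
    have "1 * \<sigma>\<^sup>2 \<le> 2 * pi * \<sigma>\<^sup>2" using pi_gt3 by (intro mult_right_mono) auto
    then have "\<sigma> \<le> sqrt (2 * pi * \<sigma>\<^sup>2)" by (intro real_le_rsqrt) simp
    then have "1 / sqrt (2 * pi * \<sigma>\<^sup>2) \<le> 1 / s" using s \<open>s \<le> \<sigma>\<close> by (intro frac_le) auto
    moreover have "exp (- (x - 0)\<^sup>2 / (2 * \<sigma>\<^sup>2)) \<le> 1" by simp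
    ultimately have "1 / sqrt (2 * pi * \<sigma>\<^sup>2) * exp (- (x - 0)\<^sup>2 / (2 * \<sigma>\<^sup>2)) \<le> 1 / s * 1"
      using s by (intro mult_mono) auto
    then show ?thesis unfolding normal_density_def by simp
  qed
  have "{\<omega> \<in> space M. \<bar>Y \<omega>\<bar> < \<epsilon>} = Y -` {-\<epsilon><..<\<epsilon>} \<inter> space M" by auto
  then have "emeasure M {\<omega> \<in> space M. \<bar>Y \<omega>\<bar> < \<epsilon>}
      = (\<integral>\<^sup>+x. ennreal (normal_density 0 \<sigma> x) * indicator {-\<epsilon><..<\<epsilon>} x \<partial>lborel)"
    using distributed_emeasure[OF D, of "{-\<epsilon><..<\<epsilon>}"] by simp
  also have "\<dots> \<le> (\<integral>\<^sup>+x. ennreal (1 / s) * indicator {-\<epsilon><..<\<epsilon>} x \<partial>lborel)"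
    by (intro nn_integral_mono mult_right_mono ennreal_leI dens) auto
  also have "\<dots> = ennreal (1 / s) * ennreal (2 * \<epsilon>)"
    using \<open>\<epsilon> > 0\<close> by (simp add: nn_integral_cmult)
  also have "\<dots> = ennreal (2 * \<epsilon> / s)" using s \<open>\<epsilon> > 0\<close> by (simp add: ennreal_mult[symmetric])
  finally show ?thesis using s \<open>\<epsilon> > 0\<close> by (simp add: emeasure_eq_measure)
qed

text \<open>The event is the increasing union of the tail intersections, each of which lies inside
  some A N.\<close>

lemma prob_eventually_le:
  assumes meas: "\<And>n. A n \<in> events" and bound: "\<And>n. prob (A n) \<le> c"
  shows "{\<omega> \<in> space M. \<forall>\<^sub>F n in sequentially. \<omega> \<in> A n} \<in> events"
    and "prob {\<omega> \<in> space M. \<forall>\<^sub>F n in sequentially. \<omega> \<in> A n} \<le> c"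
proof -
  define D where "D N = (\<Inter>n\<in>{N..}. A n)" for N
  have D_meas: "D N \<in> events" for N unfolding D_def using meas by auto
  have eq: "{\<omega> \<in> space M. \<forall>\<^sub>F n in sequentially. \<omega> \<in> A n} = (\<Union>N. D N)"
    unfolding D_def eventually_sequentially using sets.sets_into_space[OF meas] by fastforce
  show "{\<omega> \<in> space M. \<forall>\<^sub>F n in sequentially. \<omega> \<in> A n} \<in> events" unfolding eq using D_meas by auto
  have "(\<lambda>N. prob (D N)) \<longlonglongrightarrow> prob (\<Union>N. D N)"
    by (rule finite_Lim_measure_incseq) (use D_meas in \<open>auto simp: D_def incseq_def\<close>)
  moreover have "prob (D N) \<le> c" for N
  proof -
    have "prob (D N) \<le> prob (A N)" by (rule finite_measure_mono) (auto simp: D_def meas)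
    also have "\<dots> \<le> c" by (rule bound)
    finally show ?thesis .
  qed
  ultimately show "prob {\<omega> \<in> space M. \<forall>\<^sub>F n in sequentially. \<omega> \<in> A n} \<le> c"
    unfolding eq by (intro LIMSEQ_le_const2) auto
qed

text \<open>A zero limit would put \<omega>, for every \<epsilon>, into an iterated limit inferior
  of the events |S n m| < \<epsilon>, which has probability at most C \<epsilon> because the bound
  is uniform in n and m. Quantifying Z and z inside the almost-sure statement avoids any question of
  measurability or existence of the limits.\<close>

lemma AE_iterated_limit_nonzero:
  fixes S :: "nat \<Rightarrow> nat \<Rightarrow> 'a \<Rightarrow> real"
  assumes meas: "\<And>n m. S n m \<in> borel_measurable M"
    and small: "\<And>n m \<epsilon>. \<epsilon> > 0 \<Longrightarrow> prob {\<omega> \<in> space M. \<bar>S n m \<omega>\<bar> < \<epsilon>} \<le> C * \<epsilon>"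
  shows "AE \<omega> in M. \<forall>Z z. (\<forall>n. (\<lambda>m. S n m \<omega>) \<longlonglongrightarrow> Z n) \<longrightarrow> Z \<longlonglongrightarrow> z \<longrightarrow> z \<noteq> 0"
proof -
  define A where "A \<epsilon> n m = {\<omega> \<in> space M. \<bar>S n m \<omega>\<bar> < \<epsilon>}" for \<epsilon> n m
  define A1 where "A1 \<epsilon> n = {\<omega> \<in> space M. \<forall>\<^sub>F m in sequentially. \<omega> \<in> A \<epsilon> n m}" for \<epsilon> n
  define A2 where "A2 \<epsilon> = {\<omega> \<in> space M. \<forall>\<^sub>F n in sequentially. \<omega> \<in> A1 \<epsilon> n}" for \<epsilon>
  have A_meas: "A \<epsilon> n m \<in> events" for \<epsilon> n m
    unfolding A_def using meas[of n m] by measurable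
  have A1: "A1 \<epsilon> n \<in> events" "prob (A1 \<epsilon> n) \<le> C * \<epsilon>" if "\<epsilon> > 0" for \<epsilon> n
    unfolding A1_def using prob_eventually_le[of "A \<epsilon> n" "C * \<epsilon>"] A_meas small[OF that] by (auto simp: A_def)
  have A2: "A2 \<epsilon> \<in> events" "prob (A2 \<epsilon>) \<le> C * \<epsilon>" if "\<epsilon> > 0" for \<epsilon>
    unfolding A2_def using prob_eventually_le[of "A1 \<epsilon>" "C * \<epsilon>"] A1[OF that] by auto
  define N where "N = (\<Inter>j. A2 (1 / real (Suc j)))"
  have N_meas: "N \<in> events" unfolding N_def by (intro sets.countable_INT) (auto intro!: A2)
  have "prob N \<le> C * (1 / real (Suc j))" for j
  proof -
    have "prob N \<le> prob (A2 (1 / real (Suc j)))"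
      by (rule finite_measure_mono) (auto simp: N_def intro!: A2(1))
    also have "\<dots> \<le> C * (1 / real (Suc j))" by (rule A2(2)) simp
    finally show ?thesis .
  qed
  moreover have "(\<lambda>j. C * (1 / real (Suc j))) \<longlonglongrightarrow> C * 0"
    using LIMSEQ_inverse_real_of_nat by (intro tendsto_intros) (simp add: inverse_eq_divide)
  ultimately have "prob N \<le> C * 0" by (intro LIMSEQ_le_const) auto
  then have "prob N = 0" by (simp add: measure_le_0_iff)
  then have "N \<in> null_sets M" using N_meas by (simp add: null_sets_def emeasure_eq_measure)
  then have "AE \<omega> in M. \<omega> \<notin> N" by (rule AE_not_in)
  then show ?thesis
  proof (rule AE_mp, intro AE_I2 impI allI notI)
    fix \<omega> Z z
    assume \<omega>: "\<omega> \<in> space M" "\<omega> \<notin> N" and S: "\<forall>n. (\<lambda>m. S n m \<omega>) \<longlonglongrightarrow> Z n" and Z: "Z \<longlonglongrightarrow> z" "z = 0"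
    have "\<omega> \<in> A2 \<epsilon>" if "\<epsilon> > 0" for \<epsilon>
    proof -
      have "\<forall>\<^sub>F n in sequentially. \<bar>Z n\<bar> < \<epsilon>"
        using order_tendstoD(2)[OF tendsto_rabs[OF Z(1)], of \<epsilon>] Z(2) that by simp
      then have "\<forall>\<^sub>F n in sequentially. \<omega> \<in> A1 \<epsilon> n"
      proof eventually_elim
        case (elim n)
        have "\<forall>\<^sub>F m in sequentially. \<bar>S n m \<omega>\<bar> < \<epsilon>"
          using order_tendstoD(2)[OF tendsto_rabs[OF S[rule_format, of n]]] elim by simp
        then show ?case using \<omega> by (simp add: A1_def A_def)
      qed
      then show ?thesis using \<omega> by (simp add: A2_def)
    qed
    then show False using \<omega> by (auto simp: N_def)
  qed
qed

end

section \<open>Fractional Brownian motion\<close>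

lemma sum_lessThan_add_split:
  fixes f :: "nat \<Rightarrow> 'b::comm_monoid_add"
  shows "(\<Sum>i<n + k. f i) = (\<Sum>i<n. f i) + (\<Sum>i<k. f (n + i))"
  by (induction k) (simp_all add: add.assoc)

locale fractional_brownian = prob_space M for M :: "'a measure" +
  fixes H :: real and B :: "real \<Rightarrow> 'a \<Rightarrow> real"
  assumes H_gt: "H > 1/2" and fBm: "fBm M H B"
begin

lemma B_measurable: "t \<ge> 0 \<Longrightarrow> B t \<in> borel_measurable M"
  using fBm unfolding fBm_def by auto

lemma B_zero: "\<omega> \<in> space M \<Longrightarrow> B 0 \<omega> = 0"
  using fBm unfolding fBm_def by auto

lemma B_covariance:
  "t \<ge> 0 \<Longrightarrow> s \<ge> 0 \<Longrightarrow> expectation (\<lambda>\<omega>. B t \<omega> * B s \<omega>)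
     = (t powr (2*H) + s powr (2*H) - \<bar>t - s\<bar> powr (2*H)) / 2"
  using fBm unfolding fBm_def by auto

lemma B_combination_gaussian:
  "(\<And>i. i < n \<Longrightarrow> ts i \<ge> 0) \<Longrightarrow> centered_gaussian M (\<lambda>\<omega>. \<Sum>i<n. cs i * B (ts i) \<omega>)" for n :: nat
  using fBm unfolding fBm_def by auto

lemma increments_gaussian:
  fixes N :: nat
  assumes "\<And>i. t i \<ge> 0"
  shows "centered_gaussian M (\<lambda>\<omega>. \<Sum>i<N. c i * (B (t (Suc i)) \<omega> - B (t i) \<omega>))"
proof -
  \<comment> \<open>Times may repeat in the definition of \<open>fBm\<close>, so the left endpoints
    fill the first N terms and the right endpoints the last N.\<close>
  have "centered_gaussian M (\<lambda>\<omega>. \<Sum>i<N + N. (if i < N then - c i else c (i - N)) *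
      B (if i < N then t i else t (Suc (i - N))) \<omega>)"
    by (rule B_combination_gaussian) (use assms in auto)
  moreover have "(\<Sum>i<N + N. (if i < N then - c i else c (i - N)) * B (if i < N then t i else t (Suc (i - N))) \<omega>)
      = (\<Sum>i<N. c i * (B (t (Suc i)) \<omega> - B (t i) \<omega>))" for \<omega>
    unfolding sum_lessThan_add_split by (simp add: right_diff_distrib sum_subtractf sum_negf)
  ultimately show ?thesis by simp
qed

lemma B_square_integrable:
  assumes "t \<ge> 0"
  shows "integrable M (\<lambda>\<omega>. (B t \<omega>)\<^sup>2)"
proof -
  have "centered_gaussian M (\<lambda>\<omega>. \<Sum>i<(1::nat). 1 * B t \<omega>)"
    by (rule B_combination_gaussian) (use assms in auto)
  then show ?thesis using gaussian_even_moment(1)[of "B t" 1] by simp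
qed

lemma B_product_integrable:
  assumes "t \<ge> 0" "s \<ge> 0"
  shows "integrable M (\<lambda>\<omega>. B t \<omega> * B s \<omega>)"
proof (rule Bochner_Integration.integrable_bound)
  show "integrable M (\<lambda>\<omega>. (B t \<omega>)\<^sup>2 + (B s \<omega>)\<^sup>2)"
    using assms by (intro Bochner_Integration.integrable_add B_square_integrable)
  show "(\<lambda>\<omega>. B t \<omega> * B s \<omega>) \<in> borel_measurable M"
    using assms by (intro borel_measurable_times B_measurable)
  have "\<bar>x * y\<bar> \<le> \<bar>x\<^sup>2 + y\<^sup>2\<bar>" for x y :: real
  proof -
    have "2 * \<bar>x * y\<bar> \<le> x\<^sup>2 + y\<^sup>2"
      using sum_squares_bound[of "\<bar>x\<bar>" "\<bar>y\<bar>"] by (simp add: abs_mult mult.assoc)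
    then show ?thesis using abs_ge_zero[of "x * y"] by linarith
  qed
  then show "AE \<omega> in M. norm (B t \<omega> * B s \<omega>) \<le> norm ((B t \<omega>)\<^sup>2 + (B s \<omega>)\<^sup>2)" by simp
qed

lemma increment_covariance:
  assumes "a \<ge> 0" "b \<ge> 0" "c \<ge> 0" "d \<ge> 0"
  shows "integrable M (\<lambda>\<omega>. (B b \<omega> - B a \<omega>) * (B d \<omega> - B c \<omega>))"
    and "expectation (\<lambda>\<omega>. (B b \<omega> - B a \<omega>) * (B d \<omega> - B c \<omega>)) =
      (\<bar>b - c\<bar> powr (2*H) + \<bar>a - d\<bar> powr (2*H) - \<bar>b - d\<bar> powr (2*H) - \<bar>a - c\<bar> powr (2*H)) / 2"
proof -
  note int = B_product_integrable[OF assms(2,4)] B_product_integrable[OF assms(2,3)]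
    B_product_integrable[OF assms(1,4)] B_product_integrable[OF assms(1,3)]
  have eq: "(\<lambda>\<omega>. (B b \<omega> - B a \<omega>) * (B d \<omega> - B c \<omega>)) =
      (\<lambda>\<omega>. B b \<omega> * B d \<omega> - B b \<omega> * B c \<omega> - (B a \<omega> * B d \<omega> - B a \<omega> * B c \<omega>))"
    by (simp add: algebra_simps)
  show "integrable M (\<lambda>\<omega>. (B b \<omega> - B a \<omega>) * (B d \<omega> - B c \<omega>))"
    unfolding eq using int by simp
  show "expectation (\<lambda>\<omega>. (B b \<omega> - B a \<omega>) * (B d \<omega> - B c \<omega>)) =
      (\<bar>b - c\<bar> powr (2*H) + \<bar>a - d\<bar> powr (2*H) - \<bar>b - d\<bar> powr (2*H) - \<bar>a - c\<bar> powr (2*H)) / 2"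
    unfolding eq using int assms by (simp add: B_covariance field_simps)
qed

text \<open>H > 1/2 makes |x|^(2H) convex, and the covariance is half the gap in
  \<open>convex_on_spread\<close> with outer points b - c, a - d and inner points b - d, a - c. The
  intervals may overlap.\<close>

lemma increment_covariance_nonneg:
  assumes "0 \<le> a" "a \<le> b" "0 \<le> c" "c \<le> d"
  shows "0 \<le> expectation (\<lambda>\<omega>. (B b \<omega> - B a \<omega>) * (B d \<omega> - B c \<omega>))"
proof -
  have "convex_on UNIV (\<lambda>x. \<bar>x\<bar> powr (2 * H))" using H_gt by (intro convex_on_abs_powr) simp
  from convex_on_spread[OF this, of "b - a" "d - c" "a - c"] assms
  have "\<bar>b - d\<bar> powr (2*H) + \<bar>a - c\<bar> powr (2*H) \<le> \<bar>b - c\<bar> powr (2*H) + \<bar>a - d\<bar> powr (2*H)"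
    by (simp add: algebra_simps)
  then show ?thesis using assms by (subst increment_covariance(2)) auto
qed

lemma weighted_increments_variance:
  fixes N :: nat
  assumes "mono t" "t 0 \<ge> 0"
  shows "expectation (\<lambda>\<omega>. (\<Sum>i<N. c i * (B (t (Suc i)) \<omega> - B (t i) \<omega>))\<^sup>2) =
    (\<Sum>i<N. \<Sum>j<N. c i * c j * expectation (\<lambda>\<omega>. (B (t (Suc i)) \<omega> - B (t i) \<omega>) * (B (t (Suc j)) \<omega> - B (t j) \<omega>)))"
proof -
  have t: "t i \<ge> 0" for i using monoD[OF assms(1), of 0 i] assms(2) by simp
  have "(\<Sum>i<N. c i * (B (t (Suc i)) \<omega> - B (t i) \<omega>))\<^sup>2 =
    (\<Sum>i<N. \<Sum>j<N. c i * c j * ((B (t (Suc i)) \<omega> - B (t i) \<omega>) * (B (t (Suc j)) \<omega> - B (t j) \<omega>)))" for \<omega>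
    unfolding power2_eq_square sum_product by (intro sum.cong refl) (simp only: mult_ac)
  then show ?thesis
    by (simp only:) (subst Bochner_Integration.integral_sum;
      (intro Bochner_Integration.integrable_sum integrable_mult_right increment_covariance(1) t)?;
      intro sum.cong refl; subst Bochner_Integration.integral_sum;
      (intro integrable_mult_right increment_covariance(1) t)?; simp)
qed

text \<open>All covariances and weights are nonnegative, so lowering the first K weights to d and
  dropping the others can only decrease the double sum. The remaining sum telescopes, which replaces
  any appeal to independence.\<close>

lemma weighted_increments_variance_mono:
  fixes N K :: nat
  assumes t: "mono t" "t 0 \<ge> 0" and "K \<le> N" and c: "\<And>i. i < N \<Longrightarrow> 0 \<le> c i" and d: "\<And>i. i < K \<Longrightarrow> 0 \<le> d \<and> d \<le> c i"
  shows "d\<^sup>2 * expectation (\<lambda>\<omega>. (B (t K) \<omega> - B (t 0) \<omega>)\<^sup>2)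
    \<le> expectation (\<lambda>\<omega>. (\<Sum>i<N. c i * (B (t (Suc i)) \<omega> - B (t i) \<omega>))\<^sup>2)"
proof -
  define E where "E i j = expectation (\<lambda>\<omega>. (B (t (Suc i)) \<omega> - B (t i) \<omega>) * (B (t (Suc j)) \<omega> - B (t j) \<omega>))" for i j
  have t': "t i \<ge> 0" "t i \<le> t (Suc i)" for i using monoD[OF t(1), of 0 i] monoD[OF t(1), of i "Suc i"] t(2) by simp_all
  have E: "E i j \<ge> 0" for i j unfolding E_def by (intro increment_covariance_nonneg t')
  have "d\<^sup>2 * expectation (\<lambda>\<omega>. (B (t K) \<omega> - B (t 0) \<omega>)\<^sup>2)
      = d\<^sup>2 * expectation (\<lambda>\<omega>. (\<Sum>i<K. 1 * (B (t (Suc i)) \<omega> - B (t i) \<omega>))\<^sup>2)"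
    using sum_lessThan_telescope[of "\<lambda>i. B (t i) _" K] by simp
  also have "\<dots> = (\<Sum>i<K. \<Sum>j<K. d * d * E i j)"
    unfolding weighted_increments_variance[OF t] E_def[symmetric]
    by (simp add: sum_distrib_left power2_eq_square)
  also have "\<dots> \<le> (\<Sum>i<K. \<Sum>j<K. c i * c j * E i j)"
    using d E by (intro sum_mono mult_right_mono mult_mono) (auto intro: order_trans)
  also have "\<dots> \<le> (\<Sum>i<K. \<Sum>j<N. c i * c j * E i j)"
    using c E \<open>K \<le> N\<close> by (intro sum_mono sum_mono2) auto
  also have "\<dots> \<le> (\<Sum>i<N. \<Sum>j<N. c i * c j * E i j)"
    using c E \<open>K \<le> N\<close> by (intro sum_mono2 sum_nonneg) auto
  finally show ?thesis unfolding weighted_increments_variance[OF t] E_def .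
qed

text \<open>Every horizon is an integer n + 1 \<ge> 1, so each sum contains the cells of [0, 1], on
  which the weights are at least exp (-\<theta>). This gives a variance bound independent of both n
  and m.\<close>

lemma AE_discounted_limit_nonzero:
  assumes "\<theta> > 0"
  shows "AE \<omega> in M. \<forall>Z z. (\<forall>n. (\<lambda>m. \<Sum>i<Suc n * Suc m. exp (- \<theta> * (real i / real (Suc m))) *
           (B (real (Suc i) / real (Suc m)) \<omega> - B (real i / real (Suc m)) \<omega>)) \<longlonglongrightarrow> Z n)
         \<longrightarrow> Z \<longlonglongrightarrow> z \<longrightarrow> z \<noteq> 0"
proof (rule AE_iterated_limit_nonzero[where C = "2 / exp (- \<theta>)"])
  fix n m :: nat
  define t where "t i = real i / real (Suc m)" for i
  define c where "c i = exp (- \<theta> * t i)" for i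
  define S where "S \<omega> = (\<Sum>i<Suc n * Suc m. c i * (B (t (Suc i)) \<omega> - B (t i) \<omega>))" for \<omega>
  have t: "mono t" "t 0 \<ge> 0" "\<And>i. t i \<ge> 0"
    by (auto simp: t_def mono_def divide_right_mono simp del: of_nat_Suc)
  have S_eq: "(\<lambda>\<omega>. \<Sum>i<Suc n * Suc m. exp (- \<theta> * (real i / real (Suc m))) *
           (B (real (Suc i) / real (Suc m)) \<omega> - B (real i / real (Suc m)) \<omega>)) = S"
    unfolding S_def c_def t_def ..
  have gauss: "centered_gaussian M S"
    unfolding S_def by (rule increments_gaussian) (rule t(3))
  then show "(\<lambda>\<omega>. \<Sum>i<Suc n * Suc m. exp (- \<theta> * (real i / real (Suc m))) *
           (B (real (Suc i) / real (Suc m)) \<omega> - B (real i / real (Suc m)) \<omega>)) \<in> borel_measurable M"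
    unfolding S_eq centered_gaussian_def by simp
  \<comment> \<open>With K = m + 1 the telescoped increment is B 1 - B 0.\<close>
  have "(exp (- \<theta>))\<^sup>2 * expectation (\<lambda>\<omega>. (B (t (Suc m)) \<omega> - B (t 0) \<omega>)\<^sup>2) \<le> expectation (\<lambda>\<omega>. (S \<omega>)\<^sup>2)"
    unfolding S_def
  proof (rule weighted_increments_variance_mono[OF t(1,2)])
    fix i assume "i < Suc m"
    then have "t i \<le> 1" by (simp add: t_def)
    then show "0 \<le> exp (- \<theta>) \<and> exp (- \<theta>) \<le> c i"
      using \<open>\<theta> > 0\<close> mult_left_mono[of "t i" 1 \<theta>] by (simp add: c_def)
  qed (simp_all add: c_def)
  moreover have "expectation (\<lambda>\<omega>. (B (t (Suc m)) \<omega> - B (t 0) \<omega>)\<^sup>2) = 1"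
    using increment_covariance(2)[of 0 1 0 1] H_gt by (simp add: t_def power2_eq_square del: of_nat_Suc)
  ultimately have var: "(exp (- \<theta>))\<^sup>2 \<le> expectation (\<lambda>\<omega>. (S \<omega>)\<^sup>2)" by simp
  fix \<epsilon> :: real assume "\<epsilon> > 0"
  then have "prob {\<omega> \<in> space M. \<bar>S \<omega>\<bar> < \<epsilon>} \<le> 2 * \<epsilon> / exp (- \<theta>)"
    using gaussian_small_ball[OF gauss exp_gt_zero var] by simp
  then show "prob {\<omega> \<in> space M. \<bar>\<Sum>i<Suc n * Suc m. exp (- \<theta> * (real i / real (Suc m))) *
           (B (real (Suc i) / real (Suc m)) \<omega> - B (real i / real (Suc m)) \<omega>)\<bar> < \<epsilon>} \<le> 2 / exp (- \<theta>) * \<epsilon>"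
    unfolding fun_cong[OF S_eq] by (simp del: exp_minus)
qed

lemma AE_dyadic_control:
  "\<exists>q. 0 < q \<and> q < 1 \<and> 2 * q\<^sup>2 < 1 \<and>
    (AE \<omega> in M. \<exists>n0. \<forall>n\<ge>n0. \<forall>k<4 ^ n. \<bar>B (real (Suc k) / 2 ^ n) \<omega> - B (real k / 2 ^ n) \<omega>\<bar> \<le> q ^ n)"
proof -
  \<comment> \<open>The variance of an increment at level n is v^n; v < 1/2 is exactly H >
    1/2.\<close>
  define v :: real where "v = 2 powr (- 2 * H)"
  have "v < 2 powr (- 1)" unfolding v_def using H_gt by (intro powr_less_mono) auto
  then have v: "0 < v" "v < 1/2" by (auto simp: v_def powr_minus)
  \<comment> \<open>The midpoint of v and 1/2, which becomes q^2: w < 1/2 gives 2 q^2 < 1, and v < w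
    makes the ratio of variance to squared threshold (v/w)^n decay.\<close>
  define w where "w = (v + 1/2) / 2"
  have w: "0 < w" "v < w" "w < 1/2" using v by (auto simp: w_def)
  define q where "q = sqrt w"
  have q2: "q\<^sup>2 = w" using w by (simp add: q_def)
  have q: "0 < q" "q < 1" using w by (auto simp: q_def)
  have "v / w < 1" "0 < v / w" using v w by auto
  \<comment> \<open>The value 1/8 is chosen to beat the 4^n increments of level n: 4^n * 8^(-n) =
    2^(-n) is summable.\<close>
  then obtain m0 where m0: "(v / w) ^ m0 < 1/8" using real_arch_pow_inv[of "1/8" "v / w"] by auto
  define m where "m = Suc m0"
  have "(v / w) ^ m \<le> (v / w) ^ m0"
    unfolding m_def using \<open>v / w < 1\<close> \<open>0 < v / w\<close> by (intro power_decreasing) auto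
  with m0 have m: "m > 0" "(v / w) ^ m \<le> 1/8" by (simp add: m_def, linarith)
  define K where "K = (fact (2 * m) / (2 ^ m * fact m) :: real)"
  have "K > 0" by (simp add: K_def)
  define \<Delta> where "\<Delta> n k \<omega> = B (real (Suc k) / 2 ^ n) \<omega> - B (real k / 2 ^ n) \<omega>" for n k \<omega>
  have \<Delta>_meas: "\<Delta> n k \<in> borel_measurable M" for n k
    unfolding \<Delta>_def[abs_def] by (intro borel_measurable_diff B_measurable) auto
  have tail: "prob {\<omega> \<in> space M. q ^ n < \<bar>\<Delta> n k \<omega>\<bar>} \<le> K * (1/8) ^ n" for n k
  proof -
    have "centered_gaussian M (\<lambda>\<omega>. \<Sum>i<(1::nat). 1 * (B (real (k + Suc i) / 2 ^ n) \<omega> - B (real (k + i) / 2 ^ n) \<omega>))"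
      by (rule increments_gaussian[of "\<lambda>i. real (k + i) / 2 ^ n"]) simp
    then have gauss: "centered_gaussian M (\<Delta> n k)" by (simp add: \<Delta>_def[abs_def])
    have gap: "\<bar>real (Suc k) / 2 ^ n - real k / 2 ^ n\<bar> = (1/2) ^ n"
      by (simp add: diff_divide_distrib[symmetric] power_divide)
    then have gap': "\<bar>real k / 2 ^ n - real (Suc k) / 2 ^ n\<bar> = (1/2) ^ n"
      by (simp only: abs_minus_commute)
    have "expectation (\<lambda>\<omega>. (\<Delta> n k \<omega>)\<^sup>2) = ((1/2) ^ n) powr (2 * H)"
      unfolding \<Delta>_def power2_eq_square
      by (subst increment_covariance(2), simp_all only: gap gap') simp_all
    also have "\<dots> = v ^ n"
    proof -
      have "(1/2) ^ n = 2 powr (- real n)" by (simp add: powr_minus powr_realpow power_one_over inverse_eq_divide)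
      moreover have "v ^ n = v powr real n" using v by (simp add: powr_realpow)
      ultimately show ?thesis unfolding v_def by (simp only: powr_powr) (simp add: mult.commute)
    qed
    finally have var: "expectation (\<lambda>\<omega>. (\<Delta> n k \<omega>)\<^sup>2) = v ^ n" .
    have "prob {\<omega> \<in> space M. q ^ n < \<bar>\<Delta> n k \<omega>\<bar>} \<le> K * (v ^ n / (q ^ n)\<^sup>2) ^ m"
      using gaussian_tail[OF gauss m(1), of "q ^ n"] q unfolding var K_def by simp
    also have "(v ^ n / (q ^ n)\<^sup>2) ^ m = ((v / w) ^ m) ^ n"
      unfolding q2[symmetric] by (simp add: power_divide power_mult[symmetric] mult_ac)
    also have "K * \<dots> \<le> K * (1/8) ^ n"
      using m \<open>0 < v / w\<close> \<open>K > 0\<close> by (intro mult_left_mono power_mono) auto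
    finally show ?thesis .
  qed
  define A where "A n = (\<Union>k<(4::nat) ^ n. {\<omega> \<in> space M. q ^ n < \<bar>\<Delta> n k \<omega>\<bar>})" for n
  have bad_meas: "{\<omega> \<in> space M. q ^ n < \<bar>\<Delta> n k \<omega>\<bar>} \<in> events" for n k
    using \<Delta>_meas[of n k] by measurable
  have A_meas: "A n \<in> events" for n unfolding A_def using bad_meas by auto
  have A_le: "prob (A n) \<le> K * (1/2) ^ n" for n
  proof -
    have "prob (A n) \<le> (\<Sum>k<(4::nat) ^ n. prob {\<omega> \<in> space M. q ^ n < \<bar>\<Delta> n k \<omega>\<bar>})"
      unfolding A_def by (rule finite_measure_subadditive_finite) (use bad_meas in auto)
    also have "\<dots> \<le> (\<Sum>k<(4::nat) ^ n. K * (1/8) ^ n)" by (intro sum_mono tail)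
    also have "\<dots> = K * (4 * (1/8)) ^ n" unfolding power_mult_distrib by simp
    finally show ?thesis by simp
  qed
  have "summable (\<lambda>n. K * (1/2) ^ n)" by (intro summable_mult summable_geometric) simp
  then have "summable (\<lambda>n. prob (A n))"
    by (rule summable_comparison_test'[where N = 0]) (use A_le in simp)
  then have "AE \<omega> in M. eventually (\<lambda>n. \<omega> \<in> space M - A n) sequentially"
    using A_meas by (intro borel_cantelli_AE1) (auto simp: emeasure_eq_measure)
  then have "AE \<omega> in M. \<exists>n0. \<forall>n\<ge>n0. \<forall>k<4 ^ n. \<bar>\<Delta> n k \<omega>\<bar> \<le> q ^ n"
  proof (rule AE_mp, intro AE_I2 impI)
    fix \<omega> assume "\<forall>\<^sub>F n in sequentially. \<omega> \<in> space M - A n"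
    then obtain n0 where "\<And>n. n \<ge> n0 \<Longrightarrow> \<omega> \<in> space M - A n" unfolding eventually_sequentially by blast
    then show "\<exists>n0. \<forall>n\<ge>n0. \<forall>k<4 ^ n. \<bar>\<Delta> n k \<omega>\<bar> \<le> q ^ n"
      by (intro exI[of _ n0]) (auto simp: A_def not_less)
  qed
  then show ?thesis using q q2 w unfolding \<Delta>_def by (intro exI[of _ q]) auto
qed

end

theorem theorem4p8:
  fixes M :: "'a measure" and B :: "real \<Rightarrow> 'a \<Rightarrow> real"
    and H \<theta> :: real and X :: "real \<Rightarrow> 'a \<Rightarrow> real"
  assumes "H > 1/2" and "H < 1" and "\<theta> > 0"
    and "fBm M H B"
    and "AE \<omega> in M. continuous_on {0..} (\<lambda>t. B t \<omega>)"
    and "\<And>t \<omega>. X t \<omega> = exp (\<theta> * t) * RS_integral (\<lambda>s. exp (- \<theta> * s)) (\<lambda>s. B s \<omega>) 0 t"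
  shows "AE \<omega> in M.
     ((\<lambda>T. RS_integral (\<lambda>s. exp (- 2 * \<theta> * s) * X s \<omega>) (\<lambda>s. X s \<omega>) 0 T
           / integral {0..T} (\<lambda>s. exp (- 2 * \<theta> * s) * (X s \<omega>)\<^sup>2))
      \<longlongrightarrow> \<theta>) at_top"
proof -
  interpret prob_space M using assms(4) unfolding fBm_def by blast
  interpret fractional_brownian M H B by unfold_locales (use assms in auto)
  obtain q where q: "0 < q" "q < 1" "2 * q\<^sup>2 < 1" and
    dyadic: "AE \<omega> in M. \<exists>n0. \<forall>n\<ge>n0. \<forall>k<4 ^ n. \<bar>B (real (Suc k) / 2 ^ n) \<omega> - B (real k / 2 ^ n) \<omega>\<bar> \<le> q ^ n"
    using AE_dyadic_control by blast
  show ?thesis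
    using assms(5) dyadic AE_discounted_limit_nonzero[OF \<open>\<theta> > 0\<close>] AE_space
  proof eventually_elim
    case (elim \<omega>)
    from elim(2) obtain n0 where
      "\<And>n k. n \<ge> n0 \<Longrightarrow> k < 4 ^ n \<Longrightarrow> \<bar>B (real (Suc k) / 2 ^ n) \<omega> - B (real k / 2 ^ n) \<omega>\<bar> \<le> q ^ n"
      by blast
    then interpret dyadic_control "\<lambda>t. B t \<omega>" q n0
      by unfold_locales (use elim(1) q in auto)
    interpret ou_path "\<lambda>t. B t \<omega>" \<theta>
      by unfold_locales (use \<open>\<theta> > 0\<close> elim(1) B_zero[OF elim(4)] little_half_holder[OF q(3)] quadratic_growth in auto)
    obtain z where z: "(Z \<longlongrightarrow> z) at_top" using Z_converges by blast
    \<comment> \<open>The nonvanishing statement concerns integer horizons; along them Z has the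
      same limit z.\<close>
    have "filterlim (\<lambda>n. real (Suc n)) at_top sequentially"
      using filterlim_real_sequentially by (rule filterlim_sequentially_Suc[THEN iffD2])
    then have "(\<lambda>n. Z (real (Suc n))) \<longlonglongrightarrow> z" by (rule filterlim_compose[OF z])
    moreover have "\<forall>n. (\<lambda>m. \<Sum>i<Suc n * Suc m. exp (- \<theta> * (real i / real (Suc m))) *
           (B (real (Suc i) / real (Suc m)) \<omega> - B (real i / real (Suc m)) \<omega>)) \<longlonglongrightarrow> Z (real (Suc n))"
      by (intro allI has_RS_integral_uniform_sums Z_RS) simp
    ultimately have "z \<noteq> 0" using elim(3)[rule_format, of "\<lambda>n. Z (real (Suc n))" z] by blast
    show ?case
    proof (rule estimator_tendsto[OF _ z \<open>z \<noteq> 0\<close>])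
      \<comment> \<open>For nonnegative s the definite description in \<open>X\<close> has a unique
        value, given by \<open>Z_RS\<close>; the estimator involves no other times.\<close>
      fix s :: real assume "s \<ge> 0"
      then show "X s \<omega> = exp (\<theta> * s) * Z s"
        unfolding assms(6) using RS_integral_eq[OF _ Z_RS] by simp
    qed
  qed
qed

end
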